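(* Let $\theta_0,\ldots,\theta_{m-1}$ ($m\ge3$) be a unimodular partition of the unit circle $S^1$ with associated map $B:S^1\to S^1$. The point $\sigma\in S^1$ is $B$-preperiodic (periodicity being allowed, i.e., its $B$-symbolic sequence is eventually periodic with minimal period $p\ge2$) if and only if it is quadratic over $\mathbb{Q}(i)$. If this is the case and $a_0\ldots a_{h-1}\overline{a_h\ldots a_{h+p-1}}$ is the $B$-symbolic sequence of $\sigma$ (with $p$ the minimal period and $h\ge0$ the minimal preperiod, so that $a_{h-1}\ne a_{h+p-1}$ if $h>0$), then the $B$-symbolic sequence of the Galois conjugate $\sigma'$ of $\sigma$ over $\mathbb{Q}(i)$ (which lies in $S^1$) is $a_0\ldots a_{h-1}\overline{a_{h+p-1}\ldots a_h}$. In particular, the preperiodic point $\sigma$ is periodic (i.e., $h=0$) if and only if so is $\sigma'$, if and only if $(\sigma,\sigma')\in\mathcal{S}_B$.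
   Context: $S^1=\{z\in\mathbb{C}:|z|=1\}$ is the boundary of the Poincar\'e disk. A pythagorean triple is $\mathbf{t}=(t_1,t_2,t_3)\in\mathbb{Z}^3$ with $t_3>0$, $\gcd(t_1,t_2,t_3)=1$, $t_1^2+t_2^2=t_3^2$; it is identified with the point $\theta=(t_1+t_2i)/t_3\in S^1\cap\mathbb{Q}(i)$. Let $L=\mathrm{diag}(1,1,-1)$ and $\langle \mathbf{x},\mathbf{y}\rangle=\mathbf{x}^\top L\mathbf{y}$. For distinct pythagorean triples $\mathbf{t},\mathbf{t}'$, the closed arc $[\mathbf{t},\mathbf{t}']$ going counterclockwise from $\mathbf{t}$ to $\mathbf{t}'$ is unimodular if $\mathbf{w}=(L\mathbf{t}'\times L\mathbf{t})/\langle\mathbf{t}',\mathbf{t}\rangle\in\mathbb{Z}^3$. A unimodular partition of $S^1$ is a counterclockwise cyclically ordered $m$-tuple $\mathbf{t}_0,\ldots,\mathbf{t}_{m-1}$ of pythagorean triples, $m\ge3$, such that each arc $[\mathbf{t}_a,\mathbf{t}_{a+1}]$ is unimodular (indices modulo $m$); $\theta_a\in S^1$ is the point identified with $\mathbf{t}_a$. Let $I_a=[\theta_a,\theta_{a+1})$ be the half-open counterclockwise arc, and let $\mathscr{A}_a$ be the hyperbolic reflection of the Poincar\'e disk in the geodesic with ideal endpoints $\theta_a,\theta_{a+1}$, acting on $S^1$ by $\mathscr{A}_a*z=\frac{(\theta_a+\theta_{a+1})z-2\theta_a\theta_{a+1}}{2z-(\theta_a+\theta_{a+1})}$. The map $B:S^1\to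 S^1$ is $B(\sigma)=\mathscr{A}_a*\sigma$ for $\sigma\in I_a$. The $B$-symbolic sequence of $\sigma$ is $a_0a_1a_2\ldots\in\{0,\ldots,m-1\}^\omega$, where $B^t(\sigma)\in I_{a_t}$ for all $t\ge0$. A bar denotes periodic repetition. A point $\sigma$ is $B$-terminating if its $B$-symbolic sequence has a constant tail, i.e., $B^h(\sigma)=\theta_a$ for some $h\ge0$ and some $a$. If the $B$-symbolic sequence of $\sigma$ has the form $a_0\ldots a_{h-1}\overline{a_h\ldots a_{h+p-1}}$ with minimal preperiod $h$ and minimal period $p\ge2$, then $\sigma$ is $B$-periodic if $h=0$. $\mathcal{S}_B$ is the set of all pairs $(\sigma,\rho)\in S^1\times S^1$ such that both $\sigma$ and $\rho$ are not $B$-terminating, and $\sigma,\rho$ belong to different intervals among $I_0,\ldots,I_{m-1}$. *)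

theory Defs
  imports
    "HOL-Analysis.Analysis"
    "HOL-Computational_Algebra.Polynomial"
    "HOL-Library.Stream"
begin

section \<open>Pythagorean triples and unimodular partitions\<close>

definition pythagorean_triple :: "int ^ 3 \<Rightarrow> bool" where
  "pythagorean_triple t \<longleftrightarrow>
     t $ 3 > 0 \<and> gcd (t $ 1) (gcd (t $ 2) (t $ 3)) = 1 \<and> (t $ 1)\<^sup>2 + (t $ 2)\<^sup>2 = (t $ 3)\<^sup>2"

definition circle_point :: "int ^ 3 \<Rightarrow> complex" where
  "circle_point t = (of_int (t $ 1) + of_int (t $ 2) * \<i>) / of_int (t $ 3)"

definition real_vec :: "int ^ 3 \<Rightarrow> real ^ 3" where
  "real_vec t = (\<chi> i. of_int (t $ i))"

definition lorentz_mat :: "real ^ 3 ^ 3" where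
  "lorentz_mat = vector [vector [1, 0, 0], vector [0, 1, 0], vector [0, 0, -1]]"

definition lorentz_form :: "real ^ 3 \<Rightarrow> real ^ 3 \<Rightarrow> real" where
  "lorentz_form x y = x \<bullet> (lorentz_mat *v y)"

definition unimodular_arc :: "int ^ 3 \<Rightarrow> int ^ 3 \<Rightarrow> bool" where
  "unimodular_arc t t' \<longleftrightarrow> t \<noteq> t' \<and>
     (let w = (1 / lorentz_form (real_vec t') (real_vec t)) *\<^sub>R
                cross3 (lorentz_mat *v real_vec t') (lorentz_mat *v real_vec t)
      in \<forall>i. w $ i \<in> \<int>)"

text \<open>The angle in \<open>[0, 2\<pi>)\<close> swept by going counterclockwise from \<open>u\<close> to \<open>z\<close> on the unit circle.\<close>

definition ccw_angle :: "complex \<Rightarrow> complex \<Rightarrow> real" where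
  "ccw_angle u z = Arg2pi (z / u)"

text \<open>
  An \<open>m\<close>-tuple is given by the values of \<open>t\<close> on \<open>{..<m}\<close>; other values of \<open>t\<close> are irrelevant.
  Being counterclockwise cyclically ordered is expressed by the angles measured from the first point
  increasing strictly; they all lie in \<open>[0, 2\<pi>)\<close>, so the points go around the circle exactly once.
\<close>

definition unimodular_partition :: "nat \<Rightarrow> (nat \<Rightarrow> int ^ 3) \<Rightarrow> bool" where
  "unimodular_partition m t \<longleftrightarrow>
     m \<ge> 3 \<and>
     (\<forall>a<m. pythagorean_triple (t a)) \<and>
     strict_mono_on {..<m} (\<lambda>a. ccw_angle (circle_point (t 0)) (circle_point (t a))) \<and>
     (\<forall>a<m. unimodular_arc (t a) (t (Suc a mod m)))"


section \<open>The map \<open>B\<close> and its symbolic dynamics\<close>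

definition partition_point :: "(nat \<Rightarrow> int ^ 3) \<Rightarrow> nat \<Rightarrow> complex" where
  "partition_point t a = circle_point (t a)"

definition partition_arc :: "nat \<Rightarrow> (nat \<Rightarrow> int ^ 3) \<Rightarrow> nat \<Rightarrow> complex set" where
  "partition_arc m t a =
     (let u = partition_point t a; v = partition_point t (Suc a mod m)
      in {z \<in> sphere 0 1. ccw_angle u z < ccw_angle u v})"

text \<open>
  The hyperbolic reflection in the geodesic with ideal endpoints \<open>u\<close> and \<open>v\<close>, restricted to the
  boundary circle, where it agrees with a linear fractional map since \<open>cnj z = 1 / z\<close>.
\<close>

definition circle_reflection :: "complex \<Rightarrow> complex \<Rightarrow> complex \<Rightarrow> complex" where
  "circle_reflection u v z = ((u + v) * z - 2 * u * v) / (2 * z - (u + v))"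

definition arc_index :: "nat \<Rightarrow> (nat \<Rightarrow> int ^ 3) \<Rightarrow> complex \<Rightarrow> nat" where
  "arc_index m t \<sigma> = (THE a. a < m \<and> \<sigma> \<in> partition_arc m t a)"

definition B_map :: "nat \<Rightarrow> (nat \<Rightarrow> int ^ 3) \<Rightarrow> complex \<Rightarrow> complex" where
  "B_map m t \<sigma> =
     (let a = arc_index m t \<sigma>
      in circle_reflection (partition_point t a) (partition_point t (Suc a mod m)) \<sigma>)"

definition symbolic_seq :: "nat \<Rightarrow> (nat \<Rightarrow> int ^ 3) \<Rightarrow> complex \<Rightarrow> nat stream" where
  "symbolic_seq m t \<sigma> = smap (arc_index m t) (siterate (B_map m t) \<sigma>)"

definition B_terminating :: "nat \<Rightarrow> (nat \<Rightarrow> int ^ 3) \<Rightarrow> complex \<Rightarrow> bool" where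
  "B_terminating m t \<sigma> \<longleftrightarrow> (\<exists>h a. sdrop h (symbolic_seq m t \<sigma>) = sconst a)"

text \<open>
  \<open>s\<close> is the preperiodic word \<open>u\<close> followed by the infinite repetition of \<open>v\<close>, where \<open>length u\<close> is the
  minimal preperiod and \<open>length v\<close> the minimal period.
\<close>

definition minimal_periodic_form :: "'a stream \<Rightarrow> 'a list \<Rightarrow> 'a list \<Rightarrow> bool" where
  "minimal_periodic_form s u v \<longleftrightarrow>
     v \<noteq> [] \<and> s = u @- cycle v \<and>
     (\<forall>u' v'. v' \<noteq> [] \<and> s = u' @- cycle v' \<longrightarrow> length u \<le> length u' \<and> length v \<le> length v')"

definition B_preperiodic :: "nat \<Rightarrow> (nat \<Rightarrow> int ^ 3) \<Rightarrow> complex \<Rightarrow> bool" where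
  "B_preperiodic m t \<sigma> \<longleftrightarrow>
     (\<exists>u v. minimal_periodic_form (symbolic_seq m t \<sigma>) u v \<and> length v \<ge> 2)"

definition B_periodic :: "nat \<Rightarrow> (nat \<Rightarrow> int ^ 3) \<Rightarrow> complex \<Rightarrow> bool" where
  "B_periodic m t \<sigma> \<longleftrightarrow>
     (\<exists>v. minimal_periodic_form (symbolic_seq m t \<sigma>) [] v \<and> length v \<ge> 2)"

definition S_B :: "nat \<Rightarrow> (nat \<Rightarrow> int ^ 3) \<Rightarrow> (complex \<times> complex) set" where
  "S_B m t = {(\<sigma>, \<rho>). \<sigma> \<in> sphere 0 1 \<and> \<rho> \<in> sphere 0 1 \<and>
     \<not> B_terminating m t \<sigma> \<and> \<not> B_terminating m t \<rho> \<and>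
     (\<exists>a<m. \<exists>b<m. a \<noteq> b \<and> \<sigma> \<in> partition_arc m t a \<and> \<rho> \<in> partition_arc m t b)}"


section \<open>Quadratic numbers over the Gaussian rationals\<close>

definition gaussian_rats :: "complex set" where
  "gaussian_rats = {a + b * \<i> | a b. a \<in> \<rat> \<and> b \<in> \<rat>}"

definition min_poly_over_Qi :: "complex poly \<Rightarrow> complex \<Rightarrow> bool" where
  "min_poly_over_Qi p \<sigma> \<longleftrightarrow>
     (\<forall>i. coeff p i \<in> gaussian_rats) \<and> lead_coeff p = 1 \<and> poly p \<sigma> = 0 \<and>
     (\<forall>q. (\<forall>i. coeff q i \<in> gaussian_rats) \<and> q \<noteq> 0 \<and> poly q \<sigma> = 0 \<longrightarrow> degree p \<le> degree q)"

definition quadratic_over_Qi :: "complex \<Rightarrow> bool" where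
  "quadratic_over_Qi \<sigma> \<longleftrightarrow> (\<exists>p. min_poly_over_Qi p \<sigma> \<and> degree p = 2)"

text \<open>Meaningful for \<open>\<sigma>\<close> quadratic over \<open>\<rat>(\<i>)\<close>: the other root of the minimal polynomial of \<open>\<sigma>\<close>.\<close>

definition galois_conjugate :: "complex \<Rightarrow> complex" where
  "galois_conjugate \<sigma> = (THE \<tau>. \<tau> \<noteq> \<sigma> \<and> (\<exists>p. min_poly_over_Qi p \<sigma> \<and> poly p \<tau> = 0))"

end

theory Submission
  imports Defs
begin

text \<open>
  Lift everything to Minkowski space: a point \<open>z\<close> of the circle becomes the light vector \<open>(z, 1)\<close>,
  a geodesic becomes its spacelike unit normal, and the reflections \<open>\<A>\<^sub>a\<close> become Lorentz
  reflections, integral by unimodularity. Let \<open>s\<close> be the sum of the vertex triples, a timelike vector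
  inside the ideal polygon. Reflecting away from an arc moves the Lorentz product with \<open>s\<close> by at least
  one. For light vectors this descent shows that points of \<open>\<rat>(\<i>)\<close> reach a vertex; for normals of
  geodesics it shows that two distinct points outside \<open>\<rat>(\<i>)\<close> cannot stay in common arcs forever.

  Apply the reflections chosen by \<open>\<sigma>\<close> also to a second point \<open>\<rho>\<close>. Once the two images lie in different
  arcs they do so forever, and from then on \<open>B\<close> undoes the motion of the second one, which is why the
  periodic word of the conjugate is reversed. If \<open>\<sigma>\<close> is quadratic with conjugate \<open>\<rho>\<close>, the geodesic
  joining them has an integral normal of fixed norm, and only finitely many such normals separate the
  endpoints of an arc, so the pair is periodic. Conversely, an eventually periodic \<open>\<sigma>\<close> is a coincidence
  point of two distinct Moebius maps over \<open>\<rat>(\<i>)\<close>.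
\<close>

section \<open>Lorentz reflections on the light cone\<close>

text \<open>One factor of the gain is arithmetic: \<open>lor vertex_sum (w a)\<close> is a negative
  integer. The other is an integer as well for rational points, but normals of geodesics between
  arbitrary points are not integral. For them it is geometric: disjoint geodesics have unit normals
  whose product has modulus at least one.

  After two itineraries split, the pair dynamics is invertible, because the arc of the second point
  records the reflection applied last. A repeated pair can therefore be traced back to the split
  time, which is thus the exact preperiod of both sequences.\<close>

definition lor :: "complex \<times> real \<Rightarrow> complex \<times> real \<Rightarrow> real" where
  "lor x y = fst x \<bullet> fst y - snd x * snd y"

definition light :: "complex \<Rightarrow> complex \<times> real" where
  "light z = (z, 1)"

text \<open>Unit normal of the geodesic from \<open>u\<close> to \<open>v\<close>, oriented so that it is positive exactly on the open
  counterclockwise arc from \<open>u\<close> to \<open>v\<close>.\<close>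

definition pole :: "complex \<Rightarrow> complex \<Rightarrow> complex \<times> real" where
  "pole u v = (2 * \<i> * u * v / (v - u), Re (\<i> * (u + v) / (v - u)))"

definition refl_vec :: "complex \<times> real \<Rightarrow> complex \<times> real \<Rightarrow> complex \<times> real" where
  "refl_vec w x = x - (2 * lor x w) *\<^sub>R w"

lemma lor_commute: "lor x y = lor y x"
  by (simp add: lor_def inner_commute mult.commute)

lemma lor_add_right: "lor x (y + z) = lor x y + lor x z"
  and lor_diff_left: "lor (x - y) z = lor x z - lor y z"
  and lor_diff_right: "lor x (y - z) = lor x y - lor x z"
  and lor_scale_left [simp]: "lor (c *\<^sub>R x) y = c * lor x y"
  and lor_scale_right [simp]: "lor x (c *\<^sub>R y) = c * lor x y"
  and lor_minus_left [simp]: "lor (- x) y = - lor x y"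
  and lor_minus_right [simp]: "lor x (- y) = - lor x y"
  by (simp_all add: lor_def inner_add_left inner_add_right inner_diff_left inner_diff_right algebra_simps)

lemma lor_zero_right [simp]: "lor x 0 = 0"
  by (simp add: lor_def)

lemma lor_sum_right: "lor x (sum f A) = (\<Sum>i\<in>A. lor x (f i))"
  by (induction A rule: infinite_finite_induct) (auto simp: lor_add_right)

lemma lor_nondegenerate:
  assumes "\<And>y. lor x y = lor x' y"
  shows "x = x'"
proof -
  \<comment> \<open>Negating the time coordinate of the test vector turns the indefinite form into a
    sum of two squares.\<close>
  have "lor (x - x') (fst x - fst x', - (snd x - snd x')) = 0"
    using assms by (simp add: lor_diff_left)
  then have "norm (fst x - fst x') ^ 2 + (snd x - snd x') ^ 2 = 0"
    unfolding power2_norm_eq_inner by (simp add: lor_def power2_eq_square algebra_simps)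
  then have "fst x = fst x'" "snd x = snd x'"
    by (auto simp only: sum_power2_eq_zero_iff norm_eq_zero eq_iff_diff_eq_0[symmetric])
  then show ?thesis by (simp add: prod_eq_iff)
qed

lemma lor_refl_right: "lor y (refl_vec w x) = lor y x - 2 * lor x w * lor y w"
  by (simp add: refl_vec_def lor_diff_right)

lemma lor_refl_left: "lor (refl_vec w x) y = lor x y - 2 * lor x w * lor w y"
  by (simp add: refl_vec_def lor_diff_left)

lemma lor_refl_refl: "lor w w = 1 \<Longrightarrow> lor (refl_vec w x) (refl_vec w y) = lor x y"
  by (simp add: lor_refl_left lor_refl_right lor_commute[of w x] lor_commute[of w y])
 
lemma refl_refl: "lor w w = 1 \<Longrightarrow> refl_vec w (refl_vec w x) = x"
  by (simp add: refl_vec_def lor_diff_left algebra_simps flip: scaleR_add_left)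

section \<open>Light vectors, poles and the lift of a circle reflection\<close>

lemma inner_unit_less_1:
  fixes u v :: complex
  assumes "norm u = 1" "norm v = 1" "u \<noteq> v"
  shows "u \<bullet> v < 1"
proof -
  have "(norm (u - v))\<^sup>2 = (norm u)\<^sup>2 + (norm v)\<^sup>2 - 2 * (u \<bullet> v)"
    unfolding power2_norm_eq_inner by (simp add: inner_diff inner_commute)
  moreover have "norm (u - v) > 0" using assms by simp
  then have "(norm (u - v))\<^sup>2 > 0" by simp
  ultimately show ?thesis using assms by simp
qed

lemma lor_light_light: "lor (light u) (light v) = u \<bullet> v - 1"
  by (simp add: lor_def light_def)

lemma lor_light_self: "norm u = 1 \<Longrightarrow> lor (light u) (light u) = 0"
  by (simp add: lor_light_light power2_norm_eq_inner[symmetric])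

lemma lor_light_neg:
  assumes "norm u = 1" "norm v = 1" "u \<noteq> v"
  shows "lor (light u) (light v) < 0"
  using inner_unit_less_1[OF assms] by (simp add: lor_light_light)

lemma cnj_unit: "norm z = 1 \<Longrightarrow> cnj z = inverse z"
  by (simp add: inverse_complex_def cnj.code complex_eq_iff cmod_def)

lemma Re_eq_unit: assumes "x = cnj x" shows "complex_of_real (Re x) = x"
  using assms by (simp add: complex_eq_iff)

text \<open>On the unit circle this quotient is fixed by conjugation, so the \<open>Re\<close> in
  \<open>pole\<close> discards nothing and later identities become field arithmetic in the complex
  numbers.\<close>

lemma snd_pole:
  assumes "norm u = 1" "norm v = 1" "u \<noteq> v"
  shows "of_real (snd (pole u v)) = \<i> * (u + v) / (v - u)"
proof -
  have nz: "u \<noteq> 0" "v \<noteq> 0" "v - u \<noteq> 0" "u - v \<noteq> 0" using assms by auto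
  have "cnj (\<i> * (u + v) / (v - u)) = - \<i> * (inverse u + inverse v) / (inverse v - inverse u)"
    using assms by (simp add: cnj_unit)
  also have "\<dots> = \<i> * (u + v) / (v - u)"
    using nz by (simp add: divide_simps) (simp add: algebra_simps)
  finally show ?thesis unfolding pole_def snd_conv by (intro Re_eq_unit) simp
qed

lemma lor_light_complex:
  assumes "norm z = 1"
  shows "of_real (lor x (light z)) = (cnj (fst x) * z + fst x / z) / 2 - of_real (snd x)"
proof -
  have "of_real (fst x \<bullet> z) = (cnj (fst x) * z + cnj (cnj (fst x) * z)) / 2"
    by (subst complex_add_cnj) (simp add: inner_complex_def complex_eq_iff)
  then show ?thesis using assms by (simp add: lor_def light_def cnj_unit field_simps)
qed

lemma lor_pole_light:
  assumes "norm u = 1" "norm v = 1" "u \<noteq> v" "norm z = 1"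
  shows "of_real (lor (pole u v) (light z)) = \<i> * (z - u) * (z - v) / ((v - u) * z)"
proof -
  have nz: "u \<noteq> 0" "v \<noteq> 0" "v - u \<noteq> 0" "u - v \<noteq> 0" "z \<noteq> 0" using assms by auto
  have c: "cnj (fst (pole u v)) = 2 * \<i> / (v - u)"
    using assms nz by (simp add: pole_def cnj_unit divide_simps) (simp add: algebra_simps)
  have "of_real (lor (pole u v) (light z)) = (2 * \<i> / (v - u) * z + fst (pole u v) / z) / 2 - \<i> * (u + v) / (v - u)"
    by (simp only: lor_light_complex[OF assms(4)] c snd_pole[OF assms(1-3)])
  also have "\<dots> = \<i> * (z - u) * (z - v) / ((v - u) * z)"
    using nz by (simp add: pole_def divide_simps) (simp add: algebra_simps)
  finally show ?thesis .
qed

lemma lor_pole_light_eq_0_iff: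
  assumes "norm u = 1" "norm v = 1" "u \<noteq> v" "norm z = 1"
  shows "lor (pole u v) (light z) = 0 \<longleftrightarrow> z = u \<or> z = v"
proof -
  have "lor (pole u v) (light z) = 0 \<longleftrightarrow> complex_of_real (lor (pole u v) (light z)) = 0" by simp
  then show ?thesis using assms by (subst (asm) lor_pole_light) auto
qed

lemma lor_pole_self:
  assumes "norm u = 1" "norm v = 1" "u \<noteq> v"
  shows "lor (pole u v) (pole u v) = 1"
proof -
  have nz: "u \<noteq> 0" "v \<noteq> 0" "v - u \<noteq> 0" "u - v \<noteq> 0" using assms by auto
  have "complex_of_real (lor (pole u v) (pole u v)) =
     fst (pole u v) * cnj (fst (pole u v)) - (of_real (snd (pole u v)))^2"
    by (simp add: lor_def complex_mult_cnj inner_complex_def power2_eq_square)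
  also have "\<dots> = 1"
    using nz assms unfolding snd_pole[OF assms]
    by (simp add: pole_def cnj_unit divide_simps power2_eq_square) (simp add: algebra_simps)
  finally show ?thesis by (metis of_real_eq_1_iff)
qed

text \<open>The Moebius map has its pole at the midpoint of the chord from \<open>u\<close> to
  \<open>v\<close>, which lies inside the disk.\<close>

lemma circle_reflection_denominator:
  fixes u v z :: complex
  assumes "norm u = 1" "norm v = 1" "u \<noteq> v" "norm z = 1"
  shows "2 * z - (u + v) \<noteq> 0"
proof
  assume "2 * z - (u + v) = 0"
  then have "norm (u + v) = 2" using assms by (metis eq_iff_diff_eq_0 mult.right_neutral norm_mult norm_numeral)
  then have "(norm (u + v))\<^sup>2 = 4" by simp
  moreover have "(norm (u + v))\<^sup>2 = (norm u)\<^sup>2 + (norm v)\<^sup>2 + 2 * (u \<bullet> v)"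
    unfolding power2_norm_eq_inner by (simp add: inner_add inner_commute)
  ultimately show False using inner_unit_less_1[OF assms(1-3)] assms by simp
qed

text \<open>Positivity of the factor \<open>\<mu>\<close> is what later transports signs of Lorentz
  products from \<open>z\<close> to its image.\<close>

lemma refl_pole_light:
  assumes "norm u = 1" "norm v = 1" "u \<noteq> v" "norm z = 1"
  obtains \<mu> where "\<mu> > 0" "refl_vec (pole u v) (light z) = \<mu> *\<^sub>R light (circle_reflection u v z)"
    "norm (circle_reflection u v z) = 1"
proof -
  define w where "w = pole u v"
  define \<mu> where "\<mu> = snd (refl_vec w (light z))"
  have nz: "u \<noteq> 0" "v \<noteq> 0" "v - u \<noteq> 0" "u - v \<noteq> 0" "z \<noteq> 0" using assms by auto
  have den: "2 * z - (u + v) \<noteq> 0" by (rule circle_reflection_denominator[OF assms])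
  have fw: "fst w = 2 * \<i> * u * v / (v - u)" by (simp add: w_def pole_def)
  have l: "complex_of_real (lor (light z) w) = \<i> * (z - u) * (z - v) / ((v - u) * z)"
    using lor_pole_light[OF assms] by (simp add: w_def lor_commute)
  have mu: "of_real \<mu> = 1 - 2 * (\<i> * (z - u) * (z - v) / ((v - u) * z)) * (\<i> * (u + v) / (v - u))"
    using snd_pole[OF assms(1-3)] l by (simp add: \<mu>_def refl_vec_def light_def w_def)
  have "fst (refl_vec w (light z)) = z - 2 * of_real (lor (light z) w) * fst w"
    by (simp add: refl_vec_def light_def scaleR_conv_of_real)
  also have "\<dots> = z - 2 * (\<i> * (z - u) * (z - v) / ((v - u) * z)) * fst w" by (simp only: l)
  also have "\<dots> = of_real \<mu> * circle_reflection u v z"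
    unfolding mu fw circle_reflection_def using nz den
    by (simp add: divide_simps) (simp add: algebra_simps)
  finally have 1: "refl_vec w (light z) = \<mu> *\<^sub>R light (circle_reflection u v z)"
    by (simp add: prod_eq_iff light_def \<mu>_def scaleR_conv_of_real)
  have ww: "lor w w = 1" unfolding w_def by (rule lor_pole_self[OF assms(1-3)])
  have mupos: "\<mu> > 0"
  proof -
    define r where "r = snd w"
    \<comment> \<open>By Cauchy-Schwarz and \<open>(norm (fst w))^2 = 1 + r^2\<close>, \<mu> is at
      least the square of \<open>norm (fst w) - \<bar>r\<bar>\<close>, which is nonzero by the same
      relation.\<close>
    have e: "\<mu> = 1 + 2 * r^2 - 2 * r * (fst w \<bullet> z)"
      by (simp add: \<mu>_def refl_vec_def light_def lor_def r_def inner_commute power2_eq_square algebra_simps)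
    have n: "(norm (fst w))^2 = 1 + r^2" using ww unfolding power2_norm_eq_inner by (simp add: lor_def r_def power2_eq_square)
    have "\<bar>fst w \<bullet> z\<bar> \<le> norm (fst w)" using Cauchy_Schwarz_ineq2[of "fst w" z] assms by simp
    then have "r * (fst w \<bullet> z) \<le> \<bar>r\<bar> * norm (fst w)"
      by (metis abs_ge_self abs_mult mult_left_mono abs_ge_zero order_trans)
    then have "\<mu> \<ge> (norm (fst w) - \<bar>r\<bar>)^2"
      using e n by (simp add: power2_diff algebra_simps)
    moreover have "norm (fst w) \<noteq> \<bar>r\<bar>" using n by auto
    then have "(norm (fst w) - \<bar>r\<bar>)^2 > 0" by simp
    ultimately show ?thesis by linarith
  qed
  have "lor (refl_vec w (light z)) (refl_vec w (light z)) = 0"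
    using lor_refl_refl[OF ww] lor_light_self[OF assms(4)] by simp
  then have "lor (light (circle_reflection u v z)) (light (circle_reflection u v z)) = 0"
    using mupos by (simp add: 1)
  then have "norm (circle_reflection u v z) ^ 2 = 1"
    by (simp add: lor_light_light power2_norm_eq_inner)
  then have "norm (circle_reflection u v z) = 1"
    by (metis norm_ge_zero power2_eq_1_iff abs_of_nonneg abs_1 abs_minus_cancel)
  with 1 mupos that show thesis unfolding w_def by blast
qed

text \<open>These are the coordinates of a cross product divided by
  \<open>lor (light u) (light v)\<close>, the shape in which \<open>unimodular_arc\<close> presents
  the normal.\<close>

lemma pole_coords:
  assumes "norm u = 1" "norm v = 1" "u \<noteq> v"
  shows "Re (fst (pole u v)) = (Im u - Im v) / (u \<bullet> v - 1)"
    and "Im (fst (pole u v)) = (Re v - Re u) / (u \<bullet> v - 1)"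
    and "snd (pole u v) = (Im u * Re v - Re u * Im v) / (u \<bullet> v - 1)"
proof -
  have nz: "u \<noteq> 0" "v \<noteq> 0" "v - u \<noteq> 0" "u - v \<noteq> 0" using assms by auto
  have "complex_of_real (u \<bullet> v) = (cnj u * v + u * cnj v) / 2"
    by (simp add: inner_complex_def complex_eq_iff)
  then have g: "complex_of_real (u \<bullet> v - 1) = (v - u)^2 / (2 * u * v)"
    using nz assms by (simp add: cnj_unit divide_simps power2_eq_square) (simp add: algebra_simps)
  have g0: "u \<bullet> v - 1 \<noteq> 0" using inner_unit_less_1[OF assms] by simp
  have "of_real (u \<bullet> v - 1) * fst (pole u v) = \<i> * (v - u)"
    unfolding g pole_def using nz by (simp add: divide_simps power2_eq_square)
  then have "Re (of_real (u \<bullet> v - 1) * fst (pole u v)) = Re (\<i> * (v - u))"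
     "Im (of_real (u \<bullet> v - 1) * fst (pole u v)) = Im (\<i> * (v - u))" by simp_all
  then show "Re (fst (pole u v)) = (Im u - Im v) / (u \<bullet> v - 1)"
    "Im (fst (pole u v)) = (Re v - Re u) / (u \<bullet> v - 1)"
    using g0 by (simp_all add: field_simps)
  have "complex_of_real ((u \<bullet> v - 1) * snd (pole u v)) = (u * cnj v - cnj u * v) / (2 * \<i>)"
    unfolding of_real_mult g snd_pole[OF assms] using nz assms
    by (simp add: cnj_unit divide_simps power2_eq_square) (simp add: algebra_simps)
  also have "\<dots> = of_real (Im u * Re v - Re u * Im v)"
    by (simp add: complex_eq_iff) (simp add: field_simps)
  finally have "(u \<bullet> v - 1) * snd (pole u v) = Im u * Re v - Re u * Im v"
    unfolding of_real_eq_iff .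
  then show "snd (pole u v) = (Im u * Re v - Re u * Im v) / (u \<bullet> v - 1)"
    using g0 by (simp add: field_simps)
qed

text \<open>The light vectors of \<open>u\<close> and \<open>v\<close> span a hyperbolic plane and
  \<open>pole u v\<close> is a unit vector orthogonal to it; this is the form expanded in that
  basis. The sign arguments below read it term by term.\<close>

lemma lor_decomposition:
  assumes "norm u = 1" "norm v = 1" "u \<noteq> v"
  shows "lor x y = (lor x (light v) * lor y (light u) + lor x (light u) * lor y (light v)) /
     lor (light u) (light v) + lor x (pole u v) * lor y (pole u v)"
proof -
  define g where "g = u \<bullet> v - 1"
  have g0: "g \<noteq> 0" using inner_unit_less_1[OF assms] by (simp add: g_def)
  define n where "n = (Complex (Im u - Im v) (Re v - Re u), Im u * Re v - Re u * Im v)"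
  have w: "pole u v = (1 / g) *\<^sub>R n"
    unfolding n_def by (simp add: prod_eq_iff complex_eq_iff pole_coords[OF assms] g_def)
  obtain a b c where x: "x = (Complex a b, c)" by (metis complex.exhaust prod.exhaust)
  obtain a' b' c' where y: "y = (Complex a' b', c')" by (metis complex.exhaust prod.exhaust)
  obtain p q where u: "u = Complex p q" by (metis complex.exhaust)
  obtain p' q' where v: "v = Complex p' q'" by (metis complex.exhaust)
  have h: "p^2 + q^2 = 1" "p'^2 + q'^2 = 1" using assms by (auto simp: u v cmod_def)
  have "g * g * lor x y = g * (lor x (light v) * lor y (light u) + lor x (light u) * lor y (light v))
    + lor x n * lor y n"
    unfolding lor_def light_def g_def n_def x y u v inner_complex_def fst_conv snd_conv complex.sel
    using h by algebra
  then show ?thesis unfolding w lor_scale_right using g0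
    by (simp add: lor_light_light g_def[symmetric] field_simps)
qed

section \<open>Sign of a pole in terms of half angles\<close>

lemma cis_diff: "cis a - cis b = 2 * \<i> * of_real (sin ((a - b) / 2)) * cis ((a + b) / 2)"
proof -
  define x y where "x = (a + b) / 2" and "y = (a - b) / 2"
  have "a = x + y" "b = x - y" by (simp_all add: x_def y_def field_simps)
  then show ?thesis unfolding x_def[symmetric] y_def[symmetric]
    by (simp add: complex_eq_iff cos_add sin_add cos_diff sin_diff)
qed

text \<open>The base point \<theta> cancels, so the sign depends only on differences of angles
  measured from it.\<close>

lemma lor_pole_cis:
  assumes "norm \<theta> = 1" "sin ((b - a) / 2) \<noteq> 0"
  shows "lor (pole (\<theta> * cis a) (\<theta> * cis b)) (light (\<theta> * cis s)) =
    2 * sin ((s - a) / 2) * sin ((b - s) / 2) / sin ((b - a) / 2)"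
proof -
  have t: "\<theta> \<noteq> 0" using assms by auto
  have d: "cis b - cis a \<noteq> 0" using assms(2) unfolding cis_diff by simp
  have ne: "\<theta> * cis a \<noteq> \<theta> * cis b" using d t by auto
  have "complex_of_real (lor (pole (\<theta> * cis a) (\<theta> * cis b)) (light (\<theta> * cis s))) =
    \<i> * (\<theta> * cis s - \<theta> * cis a) * (\<theta> * cis s - \<theta> * cis b) / ((\<theta> * cis b - \<theta> * cis a) * (\<theta> * cis s))"
    using assms ne by (intro lor_pole_light) (auto simp: norm_mult)
  also have "\<dots> = \<i> * (cis s - cis a) * (cis s - cis b) / ((cis b - cis a) * cis s)"
    using t d by (simp add: divide_simps right_diff_distrib[symmetric])
  also have "\<dots> = of_real (- 2 * sin ((s - a) / 2) * sin ((s - b) / 2) / sin ((b - a) / 2)) *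
     (cis ((s + a) / 2) * cis ((s + b) / 2) / (cis ((b + a) / 2) * cis s))"
    using assms(2) unfolding cis_diff by (simp add: divide_simps)
  also have "cis ((s + a) / 2) * cis ((s + b) / 2) / (cis ((b + a) / 2) * cis s) = 1"
    by (simp add: cis_mult field_simps flip: add_divide_distrib)
  finally have "lor (pole (\<theta> * cis a) (\<theta> * cis b)) (light (\<theta> * cis s)) = - 2 * sin ((s - a) / 2) * sin ((s - b) / 2) / sin ((b - a) / 2)"
    unfolding mult_1_right of_real_eq_iff .
  moreover have "sin ((s - b) / 2) = - sin ((b - s) / 2)"
    by (metis minus_diff_eq minus_divide_left sin_minus)
  ultimately show ?thesis by simp
qed

section \<open>Unimodular partitions\<close>

lemma ccw_angle_cis:
  assumes "norm \<theta> = 1" "0 \<le> x" "x < 2 * pi" "0 \<le> y" "y < 2 * pi"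
  shows "ccw_angle (\<theta> * cis x) (\<theta> * cis y) = (if x \<le> y then y - x else y - x + 2 * pi)"
proof -
  have e: "(\<theta> * cis y) / (\<theta> * cis x) = cis (y - x)"
    using assms(1) by (auto simp: cis_divide[symmetric])
  have "cis (y - x) = exp (\<i> * of_real (if x \<le> y then y - x else y - x + 2 * pi))"
    by (simp add: cis_conv_exp[symmetric] complex_eq_iff)
  then show ?thesis
    unfolding ccw_angle_def e using assms
    by (intro Arg2pi_unique[of 1]) auto
qed

lemma ccw_angle_range: "0 \<le> ccw_angle u z" "ccw_angle u z < 2 * pi"
  using Arg2pi[of "z / u"] by (auto simp: ccw_angle_def)

lemma cis_ccw_angle:
  assumes "norm u = 1" "norm z = 1"
  shows "u * cis (ccw_angle u z) = z"
proof -
  have "cis (ccw_angle u z) = z / u"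
    using complex_norm_eq_1_exp[of "z / u"] assms
    by (simp add: ccw_angle_def cis_conv_exp norm_divide)
  then show ?thesis using assms by auto
qed

lemma sin_half_pos_iff:
  assumes "\<bar>x\<bar> < 2 * pi"
  shows "sin (x / 2) > 0 \<longleftrightarrow> x > 0" "sin (x / 2) < 0 \<longleftrightarrow> x < 0"
proof -
  have pos: "y > 0 \<Longrightarrow> y < 2 * pi \<Longrightarrow> sin (y / 2) > 0" for y :: real
    by (rule sin_gt_zero) auto
  have "x < 0 \<Longrightarrow> sin (x / 2) < 0" using pos[of "-x"] assms by simp
  moreover have "x > 0 \<Longrightarrow> sin (x / 2) > 0" using pos[of x] assms by simp
  ultimately show "sin (x / 2) > 0 \<longleftrightarrow> x > 0" "sin (x / 2) < 0 \<longleftrightarrow> x < 0"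
    by (cases "x = 0"; fastforce)+
qed

lemma sum_neg_strict:
  fixes f :: "'a \<Rightarrow> real"
  assumes "finite A" "i \<in> A" "f i < 0" "\<And>j. j \<in> A \<Longrightarrow> f j \<le> 0"
  shows "sum f A < 0"
  using sum_pos2[of A i "\<lambda>j. - f j"] assms by (simp add: sum_negf)

lemma circle_point_norm:
  assumes "pythagorean_triple t"
  shows "norm (circle_point t) = 1"
proof -
  define a b c where "a = real_of_int (t $ 1)" and "b = real_of_int (t $ 2)" and "c = real_of_int (t $ 3)"
  have "(t $ 1)^2 + (t $ 2)^2 = (t $ 3)^2" and c: "c > 0" using assms by (auto simp: pythagorean_triple_def c_def)
  then have h: "a^2 + b^2 = c^2" unfolding a_def b_def c_def by (metis of_int_add of_int_power)
  have "circle_point t = Complex a b / of_real c"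
    by (simp add: circle_point_def a_def b_def c_def complex_eq_iff)
  then show ?thesis using h c by (simp add: cmod_def power_divide flip: add_divide_distrib)
qed

lemma circle_point_inj:
  assumes "pythagorean_triple t" "pythagorean_triple t'" "circle_point t = circle_point t'"
  shows "t = t'"
proof -
  have pos: "t $ 3 > 0" "t' $ 3 > 0" and g: "gcd (t $ 1) (gcd (t $ 2) (t $ 3)) = 1" "gcd (t' $ 1) (gcd (t' $ 2) (t' $ 3)) = 1"
    using assms by (auto simp only: pythagorean_triple_def)
  have *: "Re (circle_point s) = of_int (s $ 1) / of_int (s $ 3)" "Im (circle_point s) = of_int (s $ 2) / of_int (s $ 3)" for s
    by (simp_all add: circle_point_def Re_divide Im_divide power2_eq_square)
  have "real_of_int (t $ 1) / of_int (t $ 3) = of_int (t' $ 1) / of_int (t' $ 3)"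
       "real_of_int (t $ 2) / of_int (t $ 3) = of_int (t' $ 2) / of_int (t' $ 3)"
    using assms(3) by (auto simp flip: *)
  then have "real_of_int (t $ 1 * t' $ 3) = real_of_int (t' $ 1 * t $ 3)"
       "real_of_int (t $ 2 * t' $ 3) = real_of_int (t' $ 2 * t $ 3)"
    using pos by (auto simp: field_simps)
  then have e: "t $ 1 * t' $ 3 = t' $ 1 * t $ 3" "t $ 2 * t' $ 3 = t' $ 2 * t $ 3" unfolding of_int_eq_iff .
  have mult: "\<bar>k\<bar> * gcd x (gcd y z) = gcd (k * x) (gcd (k * y) (k * z))" for k x y z :: int
    by (cases "k \<ge> 0") (simp_all add: gcd_mult_left abs_mult)
  \<comment> \<open>The vectors \<open>t\<close> scaled by \<open>t' $ 3\<close> and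
    \<open>t'\<close> scaled by \<open>t $ 3\<close> coincide, so the gcds of their entries do; both
    triples are primitive.\<close>
  have "\<bar>t' $ 3\<bar> * gcd (t $ 1) (gcd (t $ 2) (t $ 3)) = \<bar>t $ 3\<bar> * gcd (t' $ 1) (gcd (t' $ 2) (t' $ 3))"
    unfolding mult using e by (simp add: mult.commute)
  then have "t' $ 3 = t $ 3" unfolding g using pos by simp
  then show ?thesis using e pos by (simp add: vec_eq_iff forall_3)
qed

section \<open>Integral vectors and unimodularity\<close>

definition int_vec :: "complex \<times> real \<Rightarrow> bool" where
  "int_vec x \<longleftrightarrow> Re (fst x) \<in> \<int> \<and> Im (fst x) \<in> \<int> \<and> snd x \<in> \<int>"

lemma int_vec_add: "int_vec x \<Longrightarrow> int_vec y \<Longrightarrow> int_vec (x + y)"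
  and int_vec_diff: "int_vec x \<Longrightarrow> int_vec y \<Longrightarrow> int_vec (x - y)"
  and int_vec_scale: "c \<in> \<int> \<Longrightarrow> int_vec x \<Longrightarrow> int_vec (c *\<^sub>R x)"
  and int_vec_zero: "int_vec 0"
  by (auto simp: int_vec_def)

lemma int_vec_sum: "(\<And>i. i \<in> A \<Longrightarrow> int_vec (f i)) \<Longrightarrow> int_vec (sum f A)"
  by (induction A rule: infinite_finite_induct) (auto simp: int_vec_add int_vec_zero)

lemma lor_int: "int_vec x \<Longrightarrow> int_vec y \<Longrightarrow> lor x y \<in> \<int>"
  by (auto simp: int_vec_def lor_def inner_complex_def)

lemma int_vec_refl: "int_vec w \<Longrightarrow> int_vec x \<Longrightarrow> int_vec (refl_vec w x)"
  unfolding refl_vec_def by (intro int_vec_diff int_vec_scale Ints_mult lor_int) auto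

definition triple_vec :: "int ^ 3 \<Rightarrow> complex \<times> real" where
  "triple_vec t = (Complex (of_int (t $ 1)) (of_int (t $ 2)), of_int (t $ 3))"

lemma int_vec_triple: "int_vec (triple_vec t)"
  by (simp add: int_vec_def triple_vec_def)

lemma triple_vec_eq:
  assumes "pythagorean_triple t"
  shows "triple_vec t = of_int (t $ 3) *\<^sub>R light (circle_point t)"
  using assms by (simp add: triple_vec_def light_def circle_point_def pythagorean_triple_def
      complex_eq_iff Re_divide Im_divide power2_eq_square)

text \<open>The pole is the very vector that \<open>unimodular_arc\<close> requires to be integral:
  the heights \<open>c\<close> and \<open>c'\<close> cancel between the cross product and the
  Lorentz product.\<close>

lemma unimodular_pole_int:
  assumes "pythagorean_triple t" "pythagorean_triple t'" "unimodular_arc t t'"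
  shows "int_vec (pole (circle_point t) (circle_point t'))"
proof -
  have ne: "circle_point t \<noteq> circle_point t'"
    using circle_point_inj[OF assms(1,2)] assms(3) by (auto simp: unimodular_arc_def)
  define a b c where abc: "a = real_of_int (t $ 1)" "b = real_of_int (t $ 2)" "c = real_of_int (t $ 3)"
  define a' b' c' where abc': "a' = real_of_int (t' $ 1)" "b' = real_of_int (t' $ 2)" "c' = real_of_int (t' $ 3)"
  have c: "c > 0" "c' > 0" using assms by (auto simp: pythagorean_triple_def abc abc')
  define u v where uv: "u = circle_point t" "v = circle_point t'"
  have u: "Re u = a / c" "Im u = b / c" and v: "Re v = a' / c'" "Im v = b' / c'"
    by (simp_all add: uv circle_point_def abc abc' Re_divide Im_divide power2_eq_square)
  define L where "L = lorentz_mat *v real_vec t" 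
  define L' where "L' = lorentz_mat *v real_vec t'" 
  have L: "L $ 1 = a" "L $ 2 = b" "L $ 3 = - c" "L' $ 1 = a'" "L' $ 2 = b'" "L' $ 3 = - c'"
    by (simp_all add: L_def L'_def lorentz_mat_def real_vec_def matrix_vector_mult_def sum_3 abc abc')
  have g: "lorentz_form (real_vec t') (real_vec t) = a * a' + b * b' - c * c'"
    using L by (simp add: lorentz_form_def L_def[symmetric] inner_vec_def sum_3) (simp add: real_vec_def abc abc')
  have "u \<bullet> v - 1 < 0" using inner_unit_less_1[OF circle_point_norm[OF assms(1)] circle_point_norm[OF assms(2)] ne]
    by (simp add: uv)
  moreover have gg: "u \<bullet> v - 1 = (a * a' + b * b' - c * c') / (c * c')"
    using c by (simp add: inner_complex_def u v field_simps)
  ultimately have g0: "a * a' + b * b' - c * c' \<noteq> 0" by auto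
  have P: "Re (fst (pole u v)) = (b * c' - b' * c) / (a * a' + b * b' - c * c')"
    "Im (fst (pole u v)) = (a' * c - a * c') / (a * a' + b * b' - c * c')"
    "snd (pole u v) = (b * a' - a * b') / (a * a' + b * b' - c * c')"
    using pole_coords[OF circle_point_norm[OF assms(1)] circle_point_norm[OF assms(2)] ne] c g0
    unfolding uv[symmetric] gg by (simp_all add: u v) (simp_all add: field_simps)
  define W where "W = (1 / lorentz_form (real_vec t') (real_vec t)) *\<^sub>R cross3 L' L"
  have "\<forall>i. W $ i \<in> \<int>" using assms(3) by (simp add: unimodular_arc_def W_def L_def L'_def)
  moreover have "W $ 1 = Re (fst (pole u v))" "W $ 2 = Im (fst (pole u v))" "W $ 3 = snd (pole u v)"
    unfolding P W_def by (simp_all add: g cross3_def L)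
  ultimately show ?thesis unfolding int_vec_def uv[symmetric] by metis
qed

locale partition =
  fixes m :: nat and t :: "nat \<Rightarrow> int ^ 3"
  assumes partition: "unimodular_partition m t"
begin

abbreviation P :: "nat \<Rightarrow> complex" where "P \<equiv> partition_point t"
abbreviation Q :: "nat \<Rightarrow> complex" where "Q a \<equiv> partition_point t (Suc a mod m)"
abbreviation R :: "nat \<Rightarrow> complex \<Rightarrow> complex" where "R a \<equiv> circle_reflection (P a) (Q a)"
abbreviation idx :: "complex \<Rightarrow> nat" where "idx \<equiv> arc_index m t"
abbreviation B :: "complex \<Rightarrow> complex" where "B \<equiv> B_map m t"
abbreviation w :: "nat \<Rightarrow> complex \<times> real" where "w a \<equiv> pole (P a) (Q a)"

section \<open>Vertices and arcs in angle coordinates\<close>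

definition angle_of :: "complex \<Rightarrow> real" where "angle_of z = ccw_angle (P 0) z"
text \<open>Index \<open>m\<close> stands for the initial vertex reached after a full turn; its
  value \<open>2 * pi\<close> makes the last arc an ordinary interval of angles.\<close>

definition vangle :: "nat \<Rightarrow> real" where "vangle a = (if a < m then angle_of (P a) else 2 * pi)"

lemma m3: "m \<ge> 3" and m0 [simp]: "0 < m"
  using partition by (auto simp: unimodular_partition_def)

lemma pyth: "a < m \<Longrightarrow> pythagorean_triple (t a)"
  using partition by (auto simp: unimodular_partition_def)

lemma P_norm [simp]: "a < m \<Longrightarrow> norm (P a) = 1"
  using circle_point_norm[OF pyth] by (simp add: partition_point_def)

lemma Q_norm [simp]: "norm (Q a) = 1"
  by simp

lemma angle_of_range: "0 \<le> angle_of z" "angle_of z < 2 * pi"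
  by (simp_all add: angle_of_def ccw_angle_range)

lemma angle_of_cis: "norm z = 1 \<Longrightarrow> P 0 * cis (angle_of z) = z"
  by (simp add: angle_of_def cis_ccw_angle)

lemma P_cis: "a < m \<Longrightarrow> P a = P 0 * cis (vangle a)"
  by (simp add: vangle_def angle_of_cis)

lemma vangle_0 [simp]: "vangle 0 = 0"
  using P_norm[of 0] by (auto simp: vangle_def angle_of_def ccw_angle_def Arg2pi_of_real[of 1, simplified])

lemma Q_cis: "a < m \<Longrightarrow> Q a = P 0 * cis (vangle (Suc a))"
proof (cases "Suc a = m")
  case True
  then show ?thesis by (simp add: vangle_def complex_eq_iff)
qed (simp add: P_cis[of "Suc a"])

lemma vangle_less: "a < b \<Longrightarrow> b \<le> m \<Longrightarrow> vangle a < vangle b"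
proof (cases "b = m")
  case True
  then show "a < b \<Longrightarrow> ?thesis" by (simp add: vangle_def angle_of_range)
next
  case False
  assume "a < b" "b \<le> m"
  then show ?thesis using partition False
    by (auto simp: unimodular_partition_def strict_mono_on_def vangle_def angle_of_def partition_point_def)
qed

lemma vangle_le: "a \<le> b \<Longrightarrow> b \<le> m \<Longrightarrow> vangle a \<le> vangle b"
  using vangle_less[of a b] by (cases "a = b") auto

lemma vangle_range: "a \<le> m \<Longrightarrow> 0 \<le> vangle a" "a < m \<Longrightarrow> vangle a < 2 * pi"
  using vangle_le[of 0 a] vangle_less[of a m] by (auto simp: vangle_def[of m])

lemma vangle_arc_less: "a < m \<Longrightarrow> vangle (Suc a) - vangle a < 2 * pi"
proof (cases "a = 0")
  case True
  have "vangle (Suc 0) < vangle m" using m3 by (intro vangle_less) auto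
  then show ?thesis using True by (simp add: vangle_def[of m])
next
  case False
  assume "a < m"
  have "vangle 0 < vangle a" using False \<open>a < m\<close> by (intro vangle_less) auto
  moreover have "vangle (Suc a) \<le> vangle m" using \<open>a < m\<close> by (intro vangle_le) auto
  ultimately show ?thesis by (simp add: vangle_def[of m])
qed

lemma mem_arc:
  assumes "norm z = 1" "a < m"
  shows "z \<in> partition_arc m t a \<longleftrightarrow> vangle a \<le> angle_of z \<and> angle_of z < vangle (Suc a)"
proof -
  have 1: "ccw_angle (P a) z = (if vangle a \<le> angle_of z then angle_of z - vangle a else angle_of z - vangle a + 2 * pi)"
    using ccw_angle_cis[of "P 0" "vangle a" "angle_of z"] assms
    by (simp add: P_cis[symmetric] angle_of_cis vangle_range angle_of_range)
  have 2: "ccw_angle (P a) (Q a) = vangle (Suc a) - vangle a"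
  proof (cases "Suc a = m")
    \<comment> \<open>The last arc ends at \<open>P 0\<close>, whose angle is 0, so
      \<open>ccw_angle\<close> takes its wrapped branch.\<close>
    case True
    moreover have "vangle 0 < vangle a" using True m3 assms by (intro vangle_less) auto
    ultimately show ?thesis using ccw_angle_cis[of "P 0" "vangle a" "vangle 0"] assms
      by (simp add: P_cis[symmetric] vangle_range) (simp add: vangle_def[of m])
  next
    case False
    moreover have "vangle a < vangle (Suc a)" using assms by (intro vangle_less) auto
    ultimately show ?thesis using ccw_angle_cis[of "P 0" "vangle a" "vangle (Suc a)"] assms
      by (simp add: P_cis[symmetric] vangle_range)
  qed
  have "vangle (Suc a) \<le> vangle m" using assms by (intro vangle_le) auto
  then have "vangle (Suc a) \<le> 2 * pi" by (simp add: vangle_def[of m])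
  moreover have "z \<in> partition_arc m t a \<longleftrightarrow> ccw_angle (P a) z < ccw_angle (P a) (Q a)"
    using assms by (simp add: partition_arc_def Let_def)
  ultimately show ?thesis unfolding 1 2
    using assms angle_of_range[of z] by auto
qed

lemma ex1_arc:
  assumes "norm z = 1"
  shows "\<exists>!a. a < m \<and> z \<in> partition_arc m t a"
proof -
  \<comment> \<open>The first vertex angle beyond \<open>z\<close>; index \<open>m\<close>
    guarantees that one exists, and the arc just before it contains \<open>z\<close>.\<close>
  define n where "n = (LEAST n. angle_of z < vangle n)"
  have "angle_of z < vangle m" by (simp add: vangle_def angle_of_range)
  then have n: "angle_of z < vangle n" "n \<le> m" unfolding n_def by (auto intro: LeastI Least_le)
  then have "n \<noteq> 0" using angle_of_range(1)[of z] by (cases n) auto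
  then obtain a where a: "n = Suc a" by (cases n) auto
  have "\<not> angle_of z < vangle a" using a not_less_Least[of a "\<lambda>n. angle_of z < vangle n"] by (simp add: n_def)
  then have ex: "a < m" "z \<in> partition_arc m t a" using n a assms by (simp_all add: mem_arc)
  moreover have "b = c" if "b < m" "c < m" "z \<in> partition_arc m t b" "z \<in> partition_arc m t c" for b c
  proof (rule ccontr)
    assume "b \<noteq> c"
    then consider "Suc b \<le> c" | "Suc c \<le> b" by linarith
    then show False
      using that assms vangle_le[of "Suc b" c] vangle_le[of "Suc c" b] by cases (auto simp: mem_arc)
  qed
  ultimately show ?thesis by blast
qed

lemma idx_less [simp]: "norm z = 1 \<Longrightarrow> idx z < m"
  and idx_mem: "norm z = 1 \<Longrightarrow> z \<in> partition_arc m t (idx z)"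
  using theI'[OF ex1_arc[of z]] by (auto simp: arc_index_def)

lemma arc_iff: "norm z = 1 \<Longrightarrow> a < m \<Longrightarrow> z \<in> partition_arc m t a \<longleftrightarrow> idx z = a"
  using ex1_arc[of z] idx_less[of z] idx_mem[of z] by blast

lemma idx_iff: "norm z = 1 \<Longrightarrow> a < m \<Longrightarrow> idx z = a \<longleftrightarrow> vangle a \<le> angle_of z \<and> angle_of z < vangle (Suc a)"
  by (simp add: arc_iff[symmetric] mem_arc)

lemma angle_of_eq_iff: "norm z = 1 \<Longrightarrow> a < m \<Longrightarrow> angle_of z = vangle a \<longleftrightarrow> z = P a"
  by (metis P_cis angle_of_cis vangle_def)

lemma idx_P [simp]: "a < m \<Longrightarrow> idx (P a) = a"
  using vangle_less[of a "Suc a"] angle_of_eq_iff[of "P a" a] by (simp add: idx_iff)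

lemma P_inj: "a < m \<Longrightarrow> b < m \<Longrightarrow> P a = P b \<Longrightarrow> a = b"
  using idx_P by metis

lemma P_neq_Q: "a < m \<Longrightarrow> P a \<noteq> Q a"
  using P_inj[of a "Suc a mod m"] m3 by (cases "Suc a = m") auto

section \<open>Sides of the arcs and their reflections\<close>

lemma w_pos_iff:
  assumes "norm z = 1" "a < m"
  shows "lor (w a) (light z) > 0 \<longleftrightarrow> idx z = a \<and> z \<noteq> P a"
proof -
  have b: "\<bar>vangle (Suc a) - vangle a\<bar> < 2 * pi" "vangle (Suc a) > vangle a"
    using vangle_arc_less[of a] vangle_less[of a "Suc a"] assms by auto
  then have s: "sin ((vangle (Suc a) - vangle a) / 2) > 0" by (simp add: sin_half_pos_iff)
  have e: "lor (w a) (light z) = 2 * sin ((angle_of z - vangle a) / 2) * sin ((vangle (Suc a) - angle_of z) / 2) / sin ((vangle (Suc a) - vangle a) / 2)"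
    using lor_pole_cis[of "P 0" "vangle (Suc a)" "vangle a" "angle_of z"] s assms
    by (simp add: P_cis[of a, symmetric] Q_cis[symmetric] angle_of_cis)
  have r: "\<bar>angle_of z - vangle a\<bar> < 2 * pi" using vangle_range[of a] angle_of_range[of z] assms by (simp add: abs_less_iff)
  have le: "vangle (Suc a) \<le> vangle m" using assms by (intro vangle_le) auto
  have am: "vangle m = 2 * pi" by (simp add: vangle_def)
  have "vangle (Suc a) > 0" using b vangle_range(1)[of a] assms by simp
  \<comment> \<open>At \<open>P 0\<close>, seen from the last arc, the difference is exactly
    \<open>2 * pi\<close>, which \<open>sin_half_pos_iff\<close> does not cover.\<close>
  then have r': "\<bar>vangle (Suc a) - angle_of z\<bar> < 2 * pi \<or> (angle_of z = 0 \<and> vangle (Suc a) = 2 * pi)"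
    using le am angle_of_range[of z] by (auto simp: abs_less_iff)
  have "lor (w a) (light z) > 0 \<longleftrightarrow> sin ((angle_of z - vangle a) / 2) * sin ((vangle (Suc a) - angle_of z) / 2) > 0"
    unfolding e using s by (simp add: zero_less_mult_iff zero_less_divide_iff)
  also have "\<dots> \<longleftrightarrow> angle_of z > vangle a \<and> angle_of z < vangle (Suc a)"
    using r'
  proof
    assume q: "\<bar>vangle (Suc a) - angle_of z\<bar> < 2 * pi"
    show ?thesis unfolding zero_less_mult_iff sin_half_pos_iff[OF q] sin_half_pos_iff[OF r] using b by auto
  next
    assume "angle_of z = 0 \<and> vangle (Suc a) = 2 * pi"
    then show ?thesis using b vangle_range(1)[of a] assms by simp
  qed
  also have "\<dots> \<longleftrightarrow> idx z = a \<and> z \<noteq> P a"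
    using idx_iff[OF assms] angle_of_eq_iff[OF assms] by auto
  finally show ?thesis .
qed

lemma w_zero_iff: "norm z = 1 \<Longrightarrow> a < m \<Longrightarrow> lor (w a) (light z) = 0 \<longleftrightarrow> z = P a \<or> z = Q a"
  using lor_pole_light_eq_0_iff[of "P a" "Q a" z] P_neq_Q by simp

lemma w_self [simp]: "a < m \<Longrightarrow> lor (w a) (w a) = 1"
  using lor_pole_self[of "P a" "Q a"] P_neq_Q by simp

lemma w_int: "a < m \<Longrightarrow> int_vec (w a)"
  using unimodular_pole_int[of "t a" "t (Suc a mod m)"] pyth partition
  by (auto simp: partition_point_def unimodular_partition_def)

lemma R_lift:
  assumes "norm z = 1" "a < m"
  obtains \<mu> where "\<mu> > 0" "refl_vec (w a) (light z) = \<mu> *\<^sub>R light (R a z)" "norm (R a z) = 1"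
  using refl_pole_light[of "P a" "Q a" z] assms P_neq_Q by (metis P_norm Q_norm)

lemma R_norm [simp]: "norm z = 1 \<Longrightarrow> a < m \<Longrightarrow> norm (R a z) = 1"
  using R_lift by blast

text \<open>Inherited from \<open>refl_refl\<close>: a light vector with last coordinate one is
  determined by its ray.\<close>

lemma R_R [simp]:
  assumes "norm z = 1" "a < m"
  shows "R a (R a z) = z"
proof -
  obtain \<mu> where 1: "\<mu> > 0" "refl_vec (w a) (light z) = \<mu> *\<^sub>R light (R a z)" using R_lift[OF assms] by blast
  obtain \<nu> where 2: "\<nu> > 0" "refl_vec (w a) (light (R a z)) = \<nu> *\<^sub>R light (R a (R a z))"
    using R_lift[OF R_norm[OF assms] assms(2)] by blast
  have "light z = refl_vec (w a) (\<mu> *\<^sub>R light (R a z))" using refl_refl[OF w_self[OF assms(2)], of "light z"] 1 by simp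
  also have "\<dots> = \<mu> *\<^sub>R refl_vec (w a) (light (R a z))"
    by (simp add: refl_vec_def scaleR_diff_right)
  also have "\<dots> = (\<mu> * \<nu>) *\<^sub>R light (R a (R a z))" by (simp add: 2)
  finally have e: "light z = (\<mu> * \<nu>) *\<^sub>R light (R a (R a z))" .
  then have "\<mu> * \<nu> = 1" by (simp add: light_def)
  with e have "light z = light (R a (R a z))" by simp
  then show ?thesis by (simp add: light_def)
qed

lemma R_P [simp]: "a < m \<Longrightarrow> R a (P a) = P a"
  using P_neq_Q[of a] by (simp add: circle_reflection_def divide_simps) (simp add: algebra_simps)

text \<open>The reflection negates its own normal, hence exchanges the two sides of the
  geodesic.\<close>

lemma w_R:
  assumes "norm z = 1" "a < m"
  obtains \<mu> where "\<mu> > 0" "lor (w a) (light z) = - \<mu> * lor (w a) (light (R a z))"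
proof -
  obtain \<mu> where 1: "\<mu> > 0" "refl_vec (w a) (light z) = \<mu> *\<^sub>R light (R a z)" using R_lift[OF assms] by blast
  have "lor (w a) (refl_vec (w a) (light z)) = - lor (w a) (light z)"
    using assms by (simp add: lor_refl_right lor_commute[of "light z"])
  then show thesis using that[of \<mu>] 1 by simp
qed

lemma idx_R_neq:
  assumes "norm z = 1" "z \<noteq> P (idx z)"
  shows "idx (R (idx z) z) \<noteq> idx z"
proof -
  have a: "idx z < m" using assms by simp
  obtain \<mu> where "\<mu> > 0" "lor (w (idx z)) (light z) = - \<mu> * lor (w (idx z)) (light (R (idx z) z))"
    using w_R[OF assms(1) a] by blast
  moreover have "lor (w (idx z)) (light z) > 0" using w_pos_iff[OF assms(1) a] assms by simp
  ultimately have "lor (w (idx z)) (light (R (idx z) z)) < 0"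
    by (auto simp: mult_less_0_iff)
  then have "R (idx z) z \<noteq> P (idx z)" "\<not> lor (w (idx z)) (light (R (idx z) z)) > 0"
    using w_zero_iff[of "P (idx z)" "idx z"] a by auto
  then show ?thesis using w_pos_iff[of "R (idx z) z" "idx z"] assms a by auto
qed

text \<open>\<open>Q a\<close> is excluded because it is fixed by the reflection and belongs to the
  next half-open arc.\<close>

lemma idx_R_eq:
  assumes "norm z = 1" "a < m" "idx z \<noteq> a" "z \<noteq> Q a"
  shows "idx (R a z) = a" "R a z \<noteq> P a"
proof -
  have "z \<noteq> P a" using assms by auto
  then have "lor (w a) (light z) < 0" using assms w_pos_iff[of z a] w_zero_iff[of z a] by force
  moreover obtain \<mu> where "\<mu> > 0" "lor (w a) (light z) = - \<mu> * lor (w a) (light (R a z))"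
    using w_R[OF assms(1,2)] by blast
  ultimately have "lor (w a) (light (R a z)) > 0"
    by (simp add: zero_less_mult_iff)
  then show "idx (R a z) = a" "R a z \<noteq> P a" using w_pos_iff[of "R a z" a] assms by auto
qed

lemma B_eq: "B z = R (idx z) z"
  by (simp add: B_map_def Let_def)

lemma B_norm [simp]: "norm z = 1 \<Longrightarrow> norm (B z) = 1"
  by (simp add: B_eq)

lemma B_pow_norm [simp]: "norm z = 1 \<Longrightarrow> norm ((B ^^ n) z) = 1"
  by (induction n) auto

section \<open>Lorentz products with the vertex sum\<close>

definition vertex_sum :: "complex \<times> real" where "vertex_sum = (\<Sum>i<m. triple_vec (t i))"

lemma vertex_sum_int: "int_vec vertex_sum"
  unfolding vertex_sum_def by (intro int_vec_sum int_vec_triple)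

lemma T_eq: "i < m \<Longrightarrow> triple_vec (t i) = of_int (t i $ 3) *\<^sub>R light (P i)"
  using triple_vec_eq[OF pyth] by (simp add: partition_point_def)

lemma t3_pos: "i < m \<Longrightarrow> real_of_int (t i $ 3) > 0"
  using pyth by (simp add: pythagorean_triple_def)

lemma w_P_nonpos: "a < m \<Longrightarrow> i < m \<Longrightarrow> lor (w a) (light (P i)) \<le> 0"
  using w_pos_iff[of "P i" a] by force

text \<open>No vertex lies strictly inside an arc, so all terms are nonpositive, and a vertex off
  both ends makes the sum negative. Integrality turns this into a gap that is uniform in
  \<open>a\<close>.\<close>

lemma vertex_sum_w:
  assumes "a < m"
  shows "lor vertex_sum (w a) \<le> -1"
proof -
  have e: "lor (w a) vertex_sum = (\<Sum>i<m. of_int (t i $ 3) * lor (w a) (light (P i)))"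
    unfolding vertex_sum_def lor_sum_right by (intro sum.cong) (auto simp: T_eq)
  \<comment> \<open>The vertex following \<open>Q a\<close>; with at least three vertices it differs
    from \<open>P a\<close> and \<open>Q a\<close>.\<close>
  define i where "i = Suc (Suc a) mod m"
  have "i < m" by (simp add: i_def)
  have "i \<noteq> a" "i \<noteq> Suc a mod m"
    using m3 assms by (auto simp: i_def mod_Suc)
  then have "lor (w a) (light (P i)) \<noteq> 0" 
    using w_zero_iff[of "P i" a] P_inj[of i a] P_inj[of i "Suc a mod m"] assms \<open>i < m\<close> by auto
  then have "lor (w a) (light (P i)) < 0" using w_P_nonpos[OF assms \<open>i < m\<close>] by simp
  then have "lor (w a) vertex_sum < 0"
    unfolding e using \<open>i < m\<close> t3_pos w_P_nonpos[OF assms]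
    by (intro sum_neg_strict[of _ i]) (auto simp: mult_nonneg_nonpos mult_pos_neg less_imp_le)
  moreover have "lor (w a) vertex_sum \<in> \<int>" using w_int[OF assms] vertex_sum_int by (rule lor_int)
  ultimately show ?thesis by (auto simp: lor_commute[of vertex_sum] elim!: Ints_cases)
qed

lemma vertex_sum_light_neg:
  assumes "norm z = 1"
  shows "lor vertex_sum (light z) < 0"
proof -
  have e: "lor (light z) vertex_sum = (\<Sum>i<m. of_int (t i $ 3) * lor (light z) (light (P i)))"
    unfolding vertex_sum_def lor_sum_right by (intro sum.cong) (auto simp: T_eq)
  have le: "lor (light z) (light (P i)) \<le> 0" if "i < m" for i
    using lor_light_neg[of z "P i"] lor_light_self[of z] assms that by (cases "z = P i") auto
  have "P 0 \<noteq> P 1" using P_inj[of 0 1] m3 by auto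
  then obtain i where "i < m" "z \<noteq> P i" using m3 by (metis One_nat_def m0 P_inj Suc_le_lessD numeral_3_eq_3 less_le_trans Suc_less_eq zero_less_Suc)
  then have "lor (light z) (light (P i)) < 0" using lor_light_neg assms by simp
  then have "lor (light z) vertex_sum < 0"
    unfolding e using \<open>i < m\<close> t3_pos le
    by (intro sum_neg_strict[of _ i]) (auto simp: mult_nonneg_nonpos mult_pos_neg less_imp_le)
  then show ?thesis by (simp add: lor_commute)
qed

end

section \<open>Rational points and itineraries\<close>

lemma gaussian_rats_iff: "z \<in> gaussian_rats \<longleftrightarrow> Re z \<in> \<rat> \<and> Im z \<in> \<rat>"
proof
  assume "z \<in> gaussian_rats"
  then obtain a b where "a \<in> \<rat>" "b \<in> \<rat>" "z = a + b * \<i>" by (auto simp: gaussian_rats_def)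
  \<comment> \<open>The coefficients in \<open>gaussian_rats\<close> are complex rationals and must
    first be recognised as real.\<close>
  moreover have "Re y \<in> \<rat> \<and> Im y = 0" if y: "y \<in> \<rat>" for y :: complex
  proof -
    obtain i j where "y = of_int i / of_int j" using Rats_cases'[OF y] by blast
    then have "y = complex_of_real (of_int i / of_int j)" by simp
    then show ?thesis by (simp del: of_real_divide)
  qed
  ultimately show "Re z \<in> \<rat> \<and> Im z \<in> \<rat>" by simp
next
  assume h: "Re z \<in> \<rat> \<and> Im z \<in> \<rat>"
  then have "complex_of_real (Re z) \<in> \<rat>" "complex_of_real (Im z) \<in> \<rat>"
    by (auto elim!: Rats_cases)
  moreover have "z = of_real (Re z) + of_real (Im z) * \<i>" by (simp add: complex_eq_iff)
  ultimately show "z \<in> gaussian_rats" unfolding gaussian_rats_def by blast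
qed

lemma gaussian_rats_closed:
  shows "0 \<in> gaussian_rats" "1 \<in> gaussian_rats" "\<i> \<in> gaussian_rats" "numeral n \<in> gaussian_rats" "of_int k \<in> gaussian_rats"
    and "x \<in> gaussian_rats \<Longrightarrow> y \<in> gaussian_rats \<Longrightarrow> x + y \<in> gaussian_rats"
    and "x \<in> gaussian_rats \<Longrightarrow> y \<in> gaussian_rats \<Longrightarrow> x - y \<in> gaussian_rats"
    and "x \<in> gaussian_rats \<Longrightarrow> y \<in> gaussian_rats \<Longrightarrow> x * y \<in> gaussian_rats"
    and "x \<in> gaussian_rats \<Longrightarrow> y \<in> gaussian_rats \<Longrightarrow> x / y \<in> gaussian_rats"
    and "x \<in> gaussian_rats \<Longrightarrow> - x \<in> gaussian_rats"
    and "x \<in> gaussian_rats \<Longrightarrow> cnj x \<in> gaussian_rats"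
  by (auto simp: gaussian_rats_iff Re_divide Im_divide)

lemma ex_int_multiple:
  assumes "Re (fst x) \<in> \<rat>" "Im (fst x) \<in> \<rat>" "snd x \<in> \<rat>"
  obtains N :: real where "N > 0" "int_vec (N *\<^sub>R x)"
proof -
  have *: "\<exists>n::int. n > 0 \<and> of_int n * y \<in> \<int>" if y: "y \<in> \<rat>" for y :: real
  proof -
    obtain a b where "b > 0" "y = of_int a / of_int b" using Rats_cases'[OF y] by metis
    then show ?thesis by (intro exI[of _ b]) auto
  qed
  obtain k l n :: int where k: "k > 0" "l > 0" "n > 0"
    "of_int k * Re (fst x) \<in> \<int>" "of_int l * Im (fst x) \<in> \<int>" "of_int n * snd x \<in> \<int>"
    using *[OF assms(1)] *[OF assms(2)] *[OF assms(3)] by metis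
  have "of_int (l * n) * (of_int k * Re (fst x)) \<in> \<int>" "of_int (k * n) * (of_int l * Im (fst x)) \<in> \<int>"
    "of_int (k * l) * (of_int n * snd x) \<in> \<int>" by (intro Ints_mult Ints_of_int k(4-6))+
  then have "int_vec (real_of_int (k * l * n) *\<^sub>R x)" by (simp add: int_vec_def mult_ac)
  then show thesis using k by (intro that[of "of_int (k * l * n)"]) auto
qed

text \<open>Only the last term of the decomposition survives: a vector orthogonal to two distinct
  light vectors is a multiple of their pole.\<close>

lemma perp_pair:
  assumes "norm u = 1" "norm v = 1" "u \<noteq> v" "lor V (light u) = 0" "lor V (light v) = 0"
  shows "lor V y = lor V (pole u v) * lor (pole u v) y"
  using lor_decomposition[OF assms(1-3), of V y] assms(4,5) by (simp add: lor_commute[of "pole u v" y])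

text \<open>A spacelike normal determines the ends of its geodesic, so finitely many normals allow
  only finitely many pairs of points.\<close>

lemma perp_zeros:
  assumes "norm u = 1" "norm v = 1" "u \<noteq> v" "lor V (light u) = 0" "lor V (light v) = 0" "lor V V > 0"
  shows "{z. norm z = 1 \<and> lor V (light z) = 0} = {u, v}"
proof -
  have "lor V (pole u v) \<noteq> 0" using perp_pair[OF assms(1-5), of V] assms(6) by auto
  then have "lor V (light z) = 0 \<longleftrightarrow> lor (pole u v) (light z) = 0" for z
    by (subst perp_pair[OF assms(1-5)]) simp
  then show ?thesis using lor_pole_light_eq_0_iff[OF assms(1-3)] assms(1,2) by auto
qed

context partition
begin

section \<open>Points off the vertices and the two descents\<close>

definition irr :: "complex \<Rightarrow> bool" where "irr z \<longleftrightarrow> norm z = 1 \<and> z \<notin> gaussian_rats"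
text \<open>As \<open>idx (P a) = a\<close>, comparing \<open>z\<close> with the left end of its own
  half-open arc excludes every vertex.\<close>

definition nonvertex :: "complex \<Rightarrow> bool" where "nonvertex z \<longleftrightarrow> norm z = 1 \<and> z \<noteq> P (idx z)"

lemma P_gauss [simp]: "P a \<in> gaussian_rats"
  by (simp add: partition_point_def circle_point_def gaussian_rats_closed)

lemma R_gauss: "z \<in> gaussian_rats \<Longrightarrow> R a z \<in> gaussian_rats"
  by (simp add: circle_reflection_def gaussian_rats_closed)

lemma irr_R: "irr z \<Longrightarrow> a < m \<Longrightarrow> irr (R a z)"
  using R_gauss[of "R a z" a] by (auto simp: irr_def)

lemma irr_nonvertex: "irr z \<Longrightarrow> nonvertex z"
  using P_gauss by (metis irr_def nonvertex_def)

lemma nonvertex_neq: "nonvertex z \<Longrightarrow> a < m \<Longrightarrow> z \<noteq> P a"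
  by (auto simp: nonvertex_def)

lemma irr_norm [simp]: "irr z \<Longrightarrow> norm z = 1"
  by (simp add: irr_def)

lemma irr_B_pow: "irr z \<Longrightarrow> irr ((B ^^ n) z)"
  by (induction n) (auto simp: B_eq irr_R)

text \<open>A point outside arc \<open>a\<close> is reflected into it, and there \<open>B\<close>
  applies the same reflection again. Hence driven orbits become inverse orbits of
  \<open>B\<close>.\<close>

lemma nonvertex_R:
  assumes "nonvertex z" "a < m" "idx z \<noteq> a"
  shows "nonvertex (R a z)" "idx (R a z) = a" "B (R a z) = z"
  using idx_R_eq[of z a] assms nonvertex_neq[OF assms(1), of "Suc a mod m"]
  by (auto simp: nonvertex_def B_eq)

lemma perp_R:
  assumes "norm z = 1" "a < m" "lor V (light z) = 0"
  shows "lor (refl_vec (w a) V) (light (R a z)) = 0"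
proof -
  obtain \<mu> where "\<mu> > 0" "refl_vec (w a) (light z) = \<mu> *\<^sub>R light (R a z)" using R_lift[OF assms(1,2)] by blast
  then show ?thesis using lor_refl_refl[OF w_self[OF assms(2)], of V "light z"] assms by simp
qed

text \<open>Along an orbit that avoids the vertices, the integer \<open>lor vertex_sum x\<close> of the corresponding integral
  light vector \<open>x\<close> strictly increases while staying negative.\<close>

lemma rational_reaches_vertex:
  assumes "norm z = 1" "z \<in> gaussian_rats"
  shows "\<exists>n. \<not> nonvertex ((B ^^ n) z)"
proof (rule ccontr)
  assume "\<not> ?thesis"
  then have nv: "nonvertex ((B ^^ n) z)" for n by blast
  obtain N where N: "N > 0" "int_vec (N *\<^sub>R light z)"
    using ex_int_multiple[of "light z"] assms by (auto simp: light_def gaussian_rats_iff)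
  define K where "K = lor vertex_sum (N *\<^sub>R light z)"
  have step: "\<exists>\<kappa>>0. int_vec (\<kappa> *\<^sub>R light ((B ^^ n) z)) \<and> lor vertex_sum (\<kappa> *\<^sub>R light ((B ^^ n) z)) \<ge> K + n" for n
  proof (induction n)
    case 0
    then show ?case using N by (auto simp: K_def)
  next
    case (Suc n)
    define y where "y = (B ^^ n) z"
    define a where "a = idx y"
    have y: "norm y = 1" "a < m" "nonvertex y" using assms nv by (auto simp: y_def a_def)
    obtain \<kappa> where k: "\<kappa> > 0" "int_vec (\<kappa> *\<^sub>R light y)" "lor vertex_sum (\<kappa> *\<^sub>R light y) \<ge> K + n"
      using Suc by (auto simp: y_def)
    obtain \<mu> where mu: "\<mu> > 0" "refl_vec (w a) (light y) = \<mu> *\<^sub>R light (R a y)" using R_lift[OF y(1,2)] by blast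
    have r: "refl_vec (w a) (\<kappa> *\<^sub>R light y) = (\<kappa> * \<mu>) *\<^sub>R light ((B ^^ Suc n) z)"
    proof -
      have "refl_vec (w a) (\<kappa> *\<^sub>R light y) = \<kappa> *\<^sub>R refl_vec (w a) (light y)"
        by (simp add: refl_vec_def scaleR_diff_right)
      then show ?thesis using mu by (simp add: B_eq y_def[symmetric] a_def)
    qed
    have i: "int_vec ((\<kappa> * \<mu>) *\<^sub>R light ((B ^^ Suc n) z))"
      unfolding r[symmetric] by (intro int_vec_refl w_int y k)
    have "lor (w a) (light y) > 0" using w_pos_iff[of y a] y by (auto simp: nonvertex_def a_def)
    then have "lor (\<kappa> *\<^sub>R light y) (w a) > 0" using k by (simp add: lor_commute)
    moreover have "lor (\<kappa> *\<^sub>R light y) (w a) \<in> \<int>" by (intro lor_int k w_int y)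
    \<comment> \<open>Integrality enters here: a positive integer is at least one, and multiplied by
      the gap of \<open>vertex_sum_w\<close> it bounds the increase from below.\<close>
    ultimately have ge: "lor (\<kappa> *\<^sub>R light y) (w a) \<ge> 1" by (auto elim!: Ints_cases)
    have "lor (\<kappa> *\<^sub>R light y) (w a) * (- lor vertex_sum (w a)) \<ge> 1 * 1"
      using ge vertex_sum_w[OF y(2)] by (intro mult_mono) auto
    then have "lor vertex_sum (refl_vec (w a) (\<kappa> *\<^sub>R light y)) \<ge> K + Suc n"
      unfolding lor_refl_right using k by simp
    then show ?case using i k mu unfolding r by (intro exI[of _ "\<kappa> * \<mu>"]) auto
  qed
  obtain n where n: "- K < real n" using reals_Archimedean2 by blast
  obtain \<kappa> where "\<kappa> > 0" "lor vertex_sum (\<kappa> *\<^sub>R light ((B ^^ n) z)) \<ge> K + n" using step by blast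
  moreover have "lor vertex_sum (light ((B ^^ n) z)) < 0" using assms by (intro vertex_sum_light_neg) simp
  then have "\<kappa> * lor vertex_sum (light ((B ^^ n) z)) < 0" using \<open>\<kappa> > 0\<close> by (simp add: mult_pos_neg)
  ultimately show False using n by simp
qed

lemma same_side_pole:
  assumes "nonvertex z" "nonvertex r" "z \<noteq> r" "idx z = idx r"
  shows "(\<forall>i<m. lor (pole z r) (light (P i)) < 0) \<or> (\<forall>i<m. lor (pole z r) (light (P i)) > 0)"
proof -
  define a where "a = idx z"
  have n: "norm z = 1" "norm r = 1" using assms by (auto simp: nonvertex_def)
  have a: "a < m" using n by (simp add: a_def)
  have ar: "\<bar>angle_of r - angle_of z\<bar> < 2 * pi" using angle_of_range[of z] angle_of_range[of r] by (simp add: abs_less_iff)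
  have "angle_of z \<noteq> angle_of r" using angle_of_cis n assms(3) by metis
  then have s: "sin ((angle_of r - angle_of z) / 2) \<noteq> 0" using sin_half_pos_iff[OF ar] by (metis diff_gt_0_iff_gt less_irrefl linorder_neqE_linordered_idom diff_less_0_iff_less)
  have bz: "vangle a < angle_of z" "angle_of z < vangle (Suc a)"
    using idx_iff[OF n(1) a] angle_of_eq_iff[OF n(1) a] assms(1) by (auto simp: nonvertex_def a_def)
  have br: "vangle a < angle_of r" "angle_of r < vangle (Suc a)"
    using idx_iff[OF n(2) a] angle_of_eq_iff[OF n(2) a] assms(2,4) by (auto simp: nonvertex_def a_def)
  have pos: "sin ((vangle i - angle_of z) / 2) * sin ((vangle i - angle_of r) / 2) > 0" if i: "i < m" for i
  proof -
    have q: "\<bar>vangle i - angle_of z\<bar> < 2 * pi" "\<bar>vangle i - angle_of r\<bar> < 2 * pi"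
      using angle_of_range[of z] angle_of_range[of r] vangle_range[of i] i by (auto simp: abs_less_iff)
    \<comment> \<open>No vertex angle lies strictly inside arc \<open>a\<close>, so every vertex has
      both \<open>z\<close> and \<open>r\<close> on the same side in angle, and the two sines share
      their sign.\<close>
    have "i \<le> a \<or> Suc a \<le> i" by linarith
    then have "vangle i \<le> vangle a \<or> vangle (Suc a) \<le> vangle i" using i a vangle_le[of i a] vangle_le[of "Suc a" i] by auto
    then show ?thesis unfolding zero_less_mult_iff sin_half_pos_iff[OF q(1)] sin_half_pos_iff[OF q(2)]
      using bz br by linarith
  qed
  have e: "lor (pole z r) (light (P i)) = - 2 / sin ((angle_of r - angle_of z) / 2) * (sin ((vangle i - angle_of z) / 2) * sin ((vangle i - angle_of r) / 2))"
    if i: "i < m" for i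
  proof -
    have "sin ((angle_of r - vangle i) / 2) = - sin ((vangle i - angle_of r) / 2)"
      by (metis minus_diff_eq minus_divide_left sin_minus)
    then show ?thesis
      using lor_pole_cis[of "P 0" "angle_of r" "angle_of z" "vangle i"] s n i
      by (simp add: P_cis[of i, symmetric] angle_of_cis)
  qed
  show ?thesis
  proof (cases "sin ((angle_of r - angle_of z) / 2) > 0")
    case True
    then have "\<forall>i<m. lor (pole z r) (light (P i)) < 0" using e pos
      by (auto intro!: mult_neg_pos divide_neg_pos divide_pos_pos)
    then show ?thesis by blast
  next
    case False
    then have "\<forall>i<m. lor (pole z r) (light (P i)) > 0" using e pos s
      by (auto intro!: divide_pos_neg)
    then show ?thesis by blast
  qed
qed

text \<open>By \<open>perp_pair\<close>, \<open>V\<close> is a nonzero multiple of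
  \<open>pole z r\<close>; the factor can only exchange the two alternatives.\<close>

lemma same_side:
  assumes "nonvertex z" "nonvertex r" "z \<noteq> r" "idx z = idx r"
    "lor V (light z) = 0" "lor V (light r) = 0" "lor V V = 1"
  shows "(\<forall>i<m. lor V (light (P i)) < 0) \<or> (\<forall>i<m. lor V (light (P i)) > 0)"
proof -
  have n: "norm z = 1" "norm r = 1" using assms by (auto simp: nonvertex_def)
  have e: "lor V y = lor V (pole z r) * lor (pole z r) y" for y
    using perp_pair n assms by blast
  have "lor V (pole z r) \<noteq> 0" using e[of V] assms(7) by auto
  then show ?thesis
    using same_side_pole[OF assms(1-4)] unfolding e[of "light _"]
    by (cases "lor V (pole z r) > 0") (auto simp: zero_less_mult_iff mult_less_0_iff)
qed

lemma light_P_Q_neg: "a < m \<Longrightarrow> lor (light (P a)) (light (Q a)) < 0"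
  using P_neq_Q by (intro lor_light_neg) auto

lemma nonvertex_neg: "nonvertex z \<Longrightarrow> a < m \<Longrightarrow> lor (light z) (light (P a)) < 0"
  using nonvertex_neq by (intro lor_light_neg) (auto simp: nonvertex_def)

text \<open>Both ends of side \<open>a\<close> lie on the negative side of the geodesic of
  \<open>V\<close>, so the two geodesics are disjoint and their unit normals have product of modulus
  above one. Expanding \<open>lor (light z) V = 0\<close> decides the sign. The bound is geometric
  rather than arithmetic, so it serves arbitrary points.\<close>

lemma descent_step:
  assumes "nonvertex z" "lor V (light z) = 0" "lor V V = 1" "\<And>i. i < m \<Longrightarrow> lor V (light (P i)) < 0"
  shows "lor V (w (idx z)) \<ge> 1"
proof -
  have n: "norm z = 1" using assms by (auto simp: nonvertex_def)
  define a where "a = idx z"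
  have a: "a < m" using n by (simp add: a_def)
  have d: "norm (P a) = 1" "norm (Q a) = 1" "P a \<noteq> Q a" using a P_neq_Q by auto
  define g where "g = lor (light (P a)) (light (Q a))"
  have g: "g < 0" unfolding g_def by (rule light_P_Q_neg[OF a])
  have "1 = 2 * (lor V (light (P a)) * lor V (light (Q a))) / g + (lor V (w a))^2"
    using lor_decomposition[OF d, of V V] assms(3) by (simp add: g_def power2_eq_square)
  moreover have "lor V (light (P a)) * lor V (light (Q a)) > 0"
    using assms(4)[of a] assms(4)[of "Suc a mod m"] a by (simp add: mult_neg_neg)
  then have "2 * (lor V (light (P a)) * lor V (light (Q a))) / g < 0" using g by (simp add: divide_pos_neg)
  ultimately have sq: "(lor V (w a))^2 > 1" by linarith
  have "0 = (lor (light z) (light (Q a)) * lor V (light (P a)) + lor (light z) (light (P a)) * lor V (light (Q a))) / g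
      + lor (light z) (w a) * lor V (w a)"
    using lor_decomposition[OF d, of "light z" V] assms(2) by (simp add: g_def lor_commute[of "light z" V])
  moreover have "lor (light z) (light (Q a)) * lor V (light (P a)) + lor (light z) (light (P a)) * lor V (light (Q a)) > 0"
    using assms(4)[of a] assms(4)[of "Suc a mod m"] nonvertex_neg[OF assms(1), of a] nonvertex_neg[OF assms(1), of "Suc a mod m"] a
    by (intro add_pos_pos mult_neg_neg) auto
  then have "(lor (light z) (light (Q a)) * lor V (light (P a)) + lor (light z) (light (P a)) * lor V (light (Q a))) / g < 0"
    using g by (simp add: divide_pos_neg)
  ultimately have "lor (light z) (w a) * lor V (w a) > 0" by linarith
  moreover have "lor (light z) (w a) > 0"
    using w_pos_iff[OF n a] assms(1) by (simp add: nonvertex_def a_def lor_commute)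
  ultimately have "lor V (w a) > 0" by (simp add: zero_less_mult_iff)
  then show ?thesis using sq abs_le_square_iff[of 1 "lor V (w a)"] unfolding a_def by simp
qed

text \<open>The normal of the geodesic joining two points with a common itinerary is reflected along
  with them. It stays negative on all vertices, so its product with \<open>vertex_sum\<close> is
  never positive, yet each step raises this product by at least one.\<close>

lemma itinerary_inj:
  assumes "\<And>n. nonvertex ((B ^^ n) z)" "\<And>n. nonvertex ((B ^^ n) r)" "\<And>n. idx ((B ^^ n) z) = idx ((B ^^ n) r)"
  shows "z = r"
proof (rule ccontr)
  assume "z \<noteq> r"
  have n: "norm z = 1" "norm r = 1" using assms(1,2)[of 0] by (auto simp: nonvertex_def)
  have ne: "(B ^^ n) z \<noteq> (B ^^ n) r" for n
  proof (induction n)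
    case (Suc n)
    show ?case
    proof
      assume "(B ^^ Suc n) z = (B ^^ Suc n) r"
      then have "R (idx ((B ^^ n) z)) (R (idx ((B ^^ n) z)) ((B ^^ n) z)) = R (idx ((B ^^ n) z)) (R (idx ((B ^^ n) z)) ((B ^^ n) r))"
        using assms(3)[of n] by (simp add: B_eq)
      then show False using Suc n by (simp del: B_map_def)
    qed
  qed (use \<open>z \<noteq> r\<close> in simp)
  define p where "p = pole z r"
  have p: "lor p p = 1" "lor p (light z) = 0" "lor p (light r) = 0"
    using lor_pole_self[OF n \<open>z \<noteq> r\<close>] lor_pole_light_eq_0_iff[OF n \<open>z \<noteq> r\<close>] n by (auto simp: p_def)
  \<comment> \<open>Of the two orientations of the normal, the one that is negative on the vertices
    is chosen.\<close>
  obtain V0 where V0: "lor V0 V0 = 1" "lor V0 (light z) = 0" "lor V0 (light r) = 0" "\<forall>i<m. lor V0 (light (P i)) < 0"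
  proof -
    have "(\<forall>i<m. lor p (light (P i)) < 0) \<or> (\<forall>i<m. lor p (light (P i)) > 0)"
      unfolding p_def using assms[of 0] \<open>z \<noteq> r\<close> by (intro same_side_pole) auto
    then show thesis using that[of p] that[of "- p"] p by auto
  qed
  have step: "\<exists>V. lor V V = 1 \<and> lor V (light ((B ^^ n) z)) = 0 \<and> lor V (light ((B ^^ n) r)) = 0 \<and>
     (\<forall>i<m. lor V (light (P i)) < 0) \<and> lor vertex_sum V \<ge> lor vertex_sum V0 + n" for n
  proof (induction n)
    case 0
    have "lor V0 V0 = 1 \<and> lor V0 (light ((B ^^ 0) z)) = 0 \<and> lor V0 (light ((B ^^ 0) r)) = 0 \<and>
     (\<forall>i<m. lor V0 (light (P i)) < 0) \<and> lor vertex_sum V0 \<ge> lor vertex_sum V0 + real 0" using V0 by simp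
    then show ?case by blast
  next
    case (Suc n)
    then obtain V where V: "lor V V = 1" "lor V (light ((B ^^ n) z)) = 0" "lor V (light ((B ^^ n) r)) = 0"
     "\<And>i. i < m \<Longrightarrow> lor V (light (P i)) < 0" "lor vertex_sum V \<ge> lor vertex_sum V0 + n" by blast
    define a where "a = idx ((B ^^ n) z)"
    have a: "a < m" using n by (simp add: a_def)
    define V' where "V' = refl_vec (w a) V"
    have B: "(B ^^ Suc n) z = R a ((B ^^ n) z)" "(B ^^ Suc n) r = R a ((B ^^ n) r)"
      using assms(3)[of n] by (simp_all add: B_eq a_def)
    have 1: "lor V' V' = 1" using lor_refl_refl[OF w_self[OF a]] V by (simp add: V'_def)
    have 2: "lor V' (light ((B ^^ Suc n) z)) = 0" "lor V' (light ((B ^^ Suc n) r)) = 0"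
      unfolding B V'_def by (intro perp_R a V; simp add: n)+
    \<comment> \<open>The reflection fixes \<open>P a\<close>, so the sign there persists and
      selects the alternative in \<open>same_side\<close>.\<close>
    have "lor (w a) (light (P a)) = 0" using w_zero_iff[of "P a" a] a by simp
    then have "lor V' (light (P a)) = lor V (light (P a))"
      by (simp add: V'_def lor_refl_left)
    then have "lor V' (light (P a)) < 0" using V(4)[OF a] by simp
    moreover have "(\<forall>i<m. lor V' (light (P i)) < 0) \<or> (\<forall>i<m. lor V' (light (P i)) > 0)"
      by (intro same_side[OF assms(1)[of "Suc n"] assms(2)[of "Suc n"] ne[of "Suc n"] assms(3)[of "Suc n"] 2 1])
    ultimately have 3: "\<forall>i<m. lor V' (light (P i)) < 0" using a by force
    have "lor V (w a) \<ge> 1" unfolding a_def by (rule descent_step[OF assms(1) V(2,1,4)])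
    then have "lor V (w a) * (- lor vertex_sum (w a)) \<ge> 1 * 1"
      using vertex_sum_w[OF a] by (intro mult_mono) auto
    then have "lor vertex_sum V' \<ge> lor vertex_sum V0 + Suc n" using V(5) by (simp add: V'_def lor_refl_right)
    with 1 2 3 show ?case by blast
  qed
  obtain n where n: "- lor vertex_sum V0 < real n" using reals_Archimedean2 by blast
  obtain V where V: "\<forall>i<m. lor V (light (P i)) < 0" "lor vertex_sum V \<ge> lor vertex_sum V0 + n" using step by blast
  have e: "lor V vertex_sum = (\<Sum>i<m. of_int (t i $ 3) * lor V (light (P i)))"
    unfolding vertex_sum_def lor_sum_right by (intro sum.cong) (auto simp: T_eq)
  have "lor V vertex_sum \<le> 0" unfolding e using V t3_pos by (intro sum_nonpos) (auto simp: mult_pos_neg less_imp_le)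
  then show False using V n by (simp add: lor_commute)
qed

end

section \<open>Eventually periodic streams\<close>

lemma cycle_snth: "v \<noteq> [] \<Longrightarrow> cycle v !! n = v ! (n mod length v)"
proof -
  assume v: "v \<noteq> []"
  have "cycle v !! n = shd (sdrop n (cycle v))" by simp
  also have "\<dots> = hd (rotate (n mod length v) v)" using v by (simp add: sdrop_cycle)
  also have "\<dots> = v ! (n mod length v)" using v by (simp add: hd_rotate_conv_nth)
  finally show ?thesis .
qed

lemma shift_cycle_periodic:
  assumes "v \<noteq> []" "n \<ge> length u"
  shows "(u @- cycle v) !! (n + length v) = (u @- cycle v) !! n"
proof -
  obtain k where "n = length u + k" using le_Suc_ex[OF assms(2)] by blast
  then show ?thesis using assms(1) by (simp add: cycle_snth add.assoc)
qed

lemma stream_ext: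
  assumes "\<And>n. s !! n = s' !! n"
  shows "s = s'"
  using smap_alt[of id s s'] assms by (simp add: stream.map_id)

lemma stream_periodicI:
  assumes "p > 0" "\<And>n. n \<ge> h \<Longrightarrow> s !! (n + p) = s !! n"
  shows "s = stake h s @- cycle (stake p (sdrop h s))"
proof (rule stream_ext)
  fix n
  have per: "s !! (h + (q + k * p)) = s !! (h + q)" for q k
  proof (induction k)
    case (Suc k)
    then show ?case using assms(2)[of "h + (q + k * p)"] by (simp add: algebra_simps)
  qed simp
  show "s !! n = (stake h s @- cycle (stake p (sdrop h s))) !! n"
  proof (cases "n < h")
    case False
    define q where "q = (n - h) mod p"
    have "stake p (sdrop h s) \<noteq> []" using assms(1) by (metis length_stake list.size(3) less_irrefl)
    then have "(stake h s @- cycle (stake p (sdrop h s))) !! n = s !! (h + q)"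
      using False assms(1) by (simp add: cycle_snth q_def sdrop_snth)
    also have "\<dots> = s !! (h + (q + (n - h) div p * p))" by (rule per[symmetric])
    also have "h + (q + (n - h) div p * p) = n" using False by (simp add: q_def)
    finally show ?thesis by simp
  qed simp
qed

lemma snth_periodic_mult:
  fixes s :: "'a stream"
  assumes "\<And>n. n \<ge> h \<Longrightarrow> s !! (n + p) = s !! n" "n \<ge> h"
  shows "s !! (n + k * p) = s !! n"
proof (induction k)
  case (Suc k)
  then show ?case using assms(1)[of "n + k * p"] assms(2) by (simp add: algebra_simps)
qed simp

text \<open>Least preperiod and least period are found separately, possibly from different
  representations; the point is that one representation attains both.\<close>

lemma ex_minimal_periodic_form:
  assumes "v \<noteq> []" "s = u @- cycle v"
  obtains u0 v0 where "minimal_periodic_form s u0 v0"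
proof -
  define A where "A h p \<longleftrightarrow> p > 0 \<and> (\<forall>n\<ge>h. s !! (n + p) = s !! n)" for h p
  have A: "A (length u') (length v')" if "v' \<noteq> []" "s = u' @- cycle v'" for u' v'
    unfolding A_def using that shift_cycle_periodic by blast
  define h where "h = (LEAST h. \<exists>p. A h p)"
  define p where "p = (LEAST p. \<exists>h. A h p)"
  have "\<exists>p. A h p" unfolding h_def by (rule LeastI_ex) (use A[OF assms] in blast)
  then obtain q where q: "A h q" by blast
  have "\<exists>h. A h p" unfolding p_def by (rule LeastI_ex) (use A[OF assms] in blast)
  then obtain g where g: "A g p" by blast
  have "A h p"
    unfolding A_def
  proof (intro conjI allI impI)
    show "p > 0" using g by (simp add: A_def)
    fix n assume n: "h \<le> n"
    have q': "\<And>n. n \<ge> h \<Longrightarrow> s !! (n + q) = s !! n" "q > 0" using q by (auto simp: A_def)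
    \<comment> \<open>Multiples of \<open>q\<close> move both positions beyond \<open>g\<close>,
      where the period \<open>p\<close> is valid, and back again.\<close>
    have "s !! (n + p) = s !! (n + p + g * q)"
      using snth_periodic_mult[OF q'(1), where n = "n + p" and k = g] n by simp
    also have "\<dots> = s !! (n + g * q + p)" by (simp add: ac_simps)
    also have "\<dots> = s !! (n + g * q)"
    proof -
      have "g \<le> g * q" using q'(2) by simp
      then have "g \<le> n + g * q" by linarith
      then show ?thesis using g by (simp add: A_def)
    qed
    also have "\<dots> = s !! n" using snth_periodic_mult[OF q'(1)] n by simp
    finally show "s !! (n + p) = s !! n" .
  qed
  then have p: "p > 0" "\<And>n. n \<ge> h \<Longrightarrow> s !! (n + p) = s !! n" by (auto simp: A_def)
  have "minimal_periodic_form s (stake h s) (stake p (sdrop h s))"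
    unfolding minimal_periodic_form_def
  proof (intro conjI allI impI)
    show "stake p (sdrop h s) \<noteq> []" using p(1) by (metis length_stake list.size(3) less_irrefl)
    show "s = stake h s @- cycle (stake p (sdrop h s))" by (rule stream_periodicI[OF p])
    fix u' v' assume "v' \<noteq> [] \<and> s = u' @- cycle v'"
    then have a: "A (length u') (length v')" using A by blast
    show "length (stake h s) \<le> length u'" unfolding length_stake h_def by (rule Least_le) (use a in blast)
    show "length (stake p (sdrop h s)) \<le> length v'" unfolding length_stake p_def by (rule Least_le) (use a in blast)
  qed
  then show thesis by (rule that)
qed

text \<open>If \<open>last u0\<close> and \<open>last v0\<close> differ, the preperiod cannot be
  shortened by rotating the period. As \<open>v0\<close> may repeat the minimal period,
  \<open>v\<close> and \<open>v0\<close> are compared through their cycles.\<close>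

lemma minimal_periodic_form_unique_preperiod:
  assumes "minimal_periodic_form s u v" "s = u0 @- cycle v0" "v0 \<noteq> []" "u0 \<noteq> [] \<Longrightarrow> last u0 \<noteq> last v0"
  shows "u = u0" "cycle v = cycle v0" "last v = last v0"
proof -
  have v: "v \<noteq> []" "s = u @- cycle v" and le: "length u \<le> length u0"
    using assms by (auto simp: minimal_periodic_form_def)
  have pv: "n \<ge> length u \<Longrightarrow> s !! (n + length v) = s !! n" for n
    using shift_cycle_periodic[OF v(1)] v(2) by simp
  have p0: "n \<ge> length u0 \<Longrightarrow> s !! (n + length v0) = s !! n" for n
    using shift_cycle_periodic[OF assms(3)] assms(2) by simp
  have lv0: "s !! (length u0 + k + (length v0 - 1)) = last v0" if "k mod length v0 = 0" for k
  proof -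
    have "(k + (length v0 - 1)) mod length v0 = length v0 - 1"
      using assms(3) that by (metis add.left_neutral diff_less length_greater_0_conv mod_add_left_eq mod_less zero_less_one)
    then show ?thesis using assms(2,3) by (simp add: cycle_snth last_conv_nth add.assoc)
  qed
  have len: "length u = length u0"
  proof (rule ccontr)
    assume "length u \<noteq> length u0"
    then have l: "length u \<le> length u0 - 1" "u0 \<noteq> []" using le by auto
    \<comment> \<open>With a shorter preperiod, the period of \<open>v\<close> would already carry
      the last letter of \<open>u0\<close> forward; \<open>length v0\<close> such periods end at the
      last letter of a copy of \<open>v0\<close>.\<close>
    have "last u0 = s !! (length u0 - 1)" using assms(2) l by (simp add: last_conv_nth)
    also have "\<dots> = s !! (length u0 - 1 + length v0 * length v)"
      using snth_periodic_mult[of "length u" s "length v", OF pv l(1)] by simp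
    also have "length u0 - 1 + length v0 * length v = length u0 + length v0 * (length v - 1) + (length v0 - 1)"
    proof -
      obtain k where "length v = Suc k" using v by (cases v) auto
      moreover obtain j where "length v0 = Suc j" using assms(3) by (cases v0) auto
      moreover obtain i where "length u0 = Suc i" using l by (cases u0) auto
      ultimately show ?thesis by simp
    qed
    also have "s !! \<dots> = last v0" by (rule lv0) simp
    finally show False using assms(4) l by simp
  qed
  show "u = u0"
  proof (rule nth_equalityI[OF len])
    fix i assume "i < length u"
    then show "u ! i = u0 ! i" using v(2) assms(2) len by (metis shift_snth_less)
  qed
  then show c: "cycle v = cycle v0" using v(2) assms(2) by simp
  \<comment> \<open>This position ends a full copy of \<open>v\<close> and a full copy of
    \<open>v0\<close> alike.\<close>
  have "last v = cycle v !! (length v * length v0 - 1)"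
  proof -
    obtain k where "length v0 = Suc k" using assms(3) by (cases v0) auto
    moreover obtain j where "length v = Suc j" using v(1) by (cases v) auto
    ultimately have "length v * length v0 - 1 = j + k * length v" by (simp add: algebra_simps)
    then have "cycle v !! (length v * length v0 - 1) = v ! (j mod length v)"
      using cycle_snth[OF v(1)] mod_mult_self1 by metis
    then show ?thesis using v(1) \<open>length v = Suc j\<close> by (simp add: last_conv_nth)
  qed
  moreover have "last v0 = cycle v0 !! (length v * length v0 - 1)"
  proof -
    obtain k where "length v0 = Suc k" using assms(3) by (cases v0) auto
    moreover obtain j where "length v = Suc j" using v(1) by (cases v) auto
    ultimately have "length v * length v0 - 1 = k + j * length v0" by (simp add: algebra_simps)
    then have "cycle v0 !! (length v * length v0 - 1) = v0 ! (k mod length v0)"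
      using cycle_snth[OF assms(3)] mod_mult_self1 by metis
    then show ?thesis using assms(3) \<open>length v0 = Suc k\<close> by (simp add: last_conv_nth)
  qed
  ultimately show "last v = last v0" using c by simp
qed

lemma cycle_concat_replicate:
  assumes "v \<noteq> []" "k > 0"
  shows "cycle (concat (replicate k v)) = cycle v"
proof (rule sym, rule stream_ext)
  fix n
  have l: "length (concat (replicate k v)) = k * length v" by (simp add: length_concat sum_list_replicate)
  have e: "concat (replicate k v) = stake (k * length v) (cycle v)" using assms by (simp add: stake_cycle)
  have p: "k * length v > 0" using assms by simp
  then have ne: "concat (replicate k v) \<noteq> []" using l by (metis length_0_conv less_irrefl)
  have "cycle (concat (replicate k v)) !! n = cycle v !! (n mod (k * length v))"
    unfolding cycle_snth[OF ne] l unfolding e by (rule stake_nth) (use p in simp)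
  also have "\<dots> = cycle v !! n" using assms by (simp add: cycle_snth mod_mod_cancel)
  finally show "cycle v !! n = cycle (concat (replicate k v)) !! n" by simp
qed

lemma rev_concat_replicate: "rev (concat (replicate k v)) = concat (replicate k (rev v))"
  by (simp add: rev_concat)

text \<open>Repeated to the common length \<open>length v0 * length v\<close>, the two words are
  equal and can be reversed literally.\<close>

lemma cycle_rev_eq:
  assumes "cycle v = cycle v0" "v \<noteq> []" "v0 \<noteq> []"
  shows "cycle (rev v) = cycle (rev v0)"
proof -
  have "concat (replicate (length v0) v) = stake (length v0 * length v) (cycle v)"
    "concat (replicate (length v) v0) = stake (length v0 * length v) (cycle v0)"
    using assms(2,3) by (simp_all add: stake_cycle)
  then have "concat (replicate (length v0) v) = concat (replicate (length v) v0)" using assms(1) by simp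
  then have "concat (replicate (length v0) (rev v)) = concat (replicate (length v) (rev v0))"
    unfolding rev_concat_replicate[symmetric] by simp
  then show ?thesis using cycle_concat_replicate[of "rev v" "length v0"] cycle_concat_replicate[of "rev v0" "length v"] assms(2,3)
    by simp
qed

section \<open>Quadratic points on the circle\<close>

text \<open>Outside Q(i), \<sigma> is a root of no nonzero polynomial over Q(i) of degree below two,
  and two monic quadratics differ by a polynomial of that kind.\<close>

lemma quadratic_root_over_Qi:
  assumes "\<sigma> \<notin> gaussian_rats" "b \<in> gaussian_rats" "c \<in> gaussian_rats" "\<sigma>\<^sup>2 + b * \<sigma> + c = 0"
  shows "min_poly_over_Qi p \<sigma> \<longleftrightarrow> p = [:c, b, 1:]"
proof -
  have deg: "degree q \<ge> 2" if "\<forall>i. coeff q i \<in> gaussian_rats" "q \<noteq> 0" "poly q \<sigma> = 0" for q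
  proof (rule ccontr)
    assume "\<not> degree q \<ge> 2"
    then have "q = [:coeff q 0, coeff q 1:]"
      by (intro poly_eqI) (auto simp: coeff_pCons coeff_eq_0 split: nat.split)
    then obtain x y where q: "q = [:x, y:]" by blast
    have xy: "x \<in> gaussian_rats" "y \<in> gaussian_rats" using that(1)[rule_format, of 0] that(1)[rule_format, of 1] by (auto simp: q)
    have "y \<noteq> 0" using that(2,3) by (auto simp: q)
    then have "\<sigma> = - x / y" using that(3) by (simp add: q field_simps add_eq_0_iff)
    moreover have "- x / y \<in> gaussian_rats" using xy by (intro gaussian_rats_closed)
    ultimately show False using assms(1) by simp
  qed
  have co: "coeff [:c, b, 1:] i \<in> gaussian_rats" for i
    using assms(2,3) by (auto simp: coeff_pCons gaussian_rats_closed split: nat.splits)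
  have p0: "poly [:c, b, 1:] \<sigma> = 0" using assms(4) by (simp add: power2_eq_square algebra_simps)
  have "min_poly_over_Qi [:c, b, 1:] \<sigma>"
    unfolding min_poly_over_Qi_def using deg co p0 by (auto simp: numeral_2_eq_2)
  moreover have "p = [:c, b, 1:]" if p: "min_poly_over_Qi p \<sigma>"
  proof (rule ccontr)
    assume ne: "p \<noteq> [:c, b, 1:]"
    have "degree p \<le> degree [:c, b, 1:]"
      using p co p0 unfolding min_poly_over_Qi_def by (metis pCons_eq_0_iff zero_neq_one)
    then have d2: "degree p = 2" using deg[of p] p by (force simp: min_poly_over_Qi_def)
    define q where "q = p - [:c, b, 1:]"
    have "coeff q i = 0" if "i \<ge> 2" for i
    proof (cases "i = 2")
      case True
      then show ?thesis using p d2 by (simp add: q_def min_poly_over_Qi_def coeff_pCons numeral_2_eq_2)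
    next
      case False
      then show ?thesis using that d2 by (simp add: q_def coeff_eq_0)
    qed
    then have "degree q < 2" using ne by (metis degree_lessI q_def eq_iff_diff_eq_0 le_degree leI leading_coeff_0_iff)
    moreover have "\<forall>i. coeff q i \<in> gaussian_rats" using p co unfolding q_def min_poly_over_Qi_def
      by (simp only: coeff_diff gaussian_rats_closed simp_thms) 
    moreover have "poly q \<sigma> = 0" using p p0 by (simp add: q_def min_poly_over_Qi_def)
    ultimately show False using deg[of q] ne by (simp add: q_def)
  qed
  ultimately show ?thesis by blast
qed

lemma quadratic_over_Qi_iff:
  "quadratic_over_Qi \<sigma> \<longleftrightarrow> \<sigma> \<notin> gaussian_rats \<and> (\<exists>b\<in>gaussian_rats. \<exists>c\<in>gaussian_rats. \<sigma>\<^sup>2 + b * \<sigma> + c = 0)"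
proof
  assume "quadratic_over_Qi \<sigma>"
  then obtain p where p: "min_poly_over_Qi p \<sigma>" "degree p = 2" by (auto simp: quadratic_over_Qi_def)
  have "\<sigma> \<notin> gaussian_rats"
  proof
    assume "\<sigma> \<in> gaussian_rats"
    then have "\<forall>i. coeff [:- \<sigma>, 1:] i \<in> gaussian_rats"
      by (auto simp: coeff_pCons gaussian_rats_closed split: nat.splits)
    then have "degree p \<le> degree [:- \<sigma>, 1:]" using p(1) unfolding min_poly_over_Qi_def
      by (metis add.right_inverse mult.right_neutral one_pCons pCons_eq_0_iff poly_pCons poly_0 zero_neq_one mult_zero_right add_0_right add.commute)
    then show False using p(2) by simp
  qed
  moreover have "coeff p (Suc (Suc 0)) = 1"
    using p by (metis min_poly_over_Qi_def numeral_2_eq_2)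
  then have "\<sigma>\<^sup>2 + coeff p 1 * \<sigma> + coeff p 0 = 0"
    using p by (simp add: min_poly_over_Qi_def poly_altdef numeral_2_eq_2 algebra_simps)
  ultimately show "\<sigma> \<notin> gaussian_rats \<and> (\<exists>b\<in>gaussian_rats. \<exists>c\<in>gaussian_rats. \<sigma>\<^sup>2 + b * \<sigma> + c = 0)"
    using p(1) by (auto simp: min_poly_over_Qi_def)
next
  assume "\<sigma> \<notin> gaussian_rats \<and> (\<exists>b\<in>gaussian_rats. \<exists>c\<in>gaussian_rats. \<sigma>\<^sup>2 + b * \<sigma> + c = 0)"
  then obtain b c where "\<sigma> \<notin> gaussian_rats" "b\<in>gaussian_rats" "c\<in>gaussian_rats" "\<sigma>\<^sup>2 + b * \<sigma> + c = 0" by blast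
  from quadratic_root_over_Qi[OF this] show "quadratic_over_Qi \<sigma>"
    by (auto simp: quadratic_over_Qi_def)
qed

lemma galois_conjugate_eq:
  assumes "\<sigma> \<notin> gaussian_rats" "b \<in> gaussian_rats" "c \<in> gaussian_rats" "\<sigma>\<^sup>2 + b * \<sigma> + c = 0"
  shows "galois_conjugate \<sigma> = - b - \<sigma>" "- b - \<sigma> \<noteq> \<sigma>" "- b - \<sigma> \<notin> gaussian_rats"
proof -
  show ne: "- b - \<sigma> \<noteq> \<sigma>"
  proof
    assume "- b - \<sigma> = \<sigma>"
    then have "\<sigma> = - b / 2" by (simp add: algebra_simps flip: mult_2)
    moreover have "- b / 2 \<in> gaussian_rats" using assms(2) by (intro gaussian_rats_closed)
    ultimately show False using assms(1) by simp
  qed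
  have "poly [:c, b, 1:] \<tau> = (\<tau> - \<sigma>) * (\<tau> - (- b - \<sigma>))" for \<tau>
    using assms(4) by (simp add: power2_eq_square) algebra
  then have "poly [:c, b, 1:] \<tau> = 0 \<longleftrightarrow> \<tau> = \<sigma> \<or> \<tau> = - b - \<sigma>" for \<tau>
    by (metis eq_iff_diff_eq_0 mult_eq_0_iff)
  then have "(\<exists>p. min_poly_over_Qi p \<sigma> \<and> poly p \<tau> = 0) \<longleftrightarrow> \<tau> = \<sigma> \<or> \<tau> = - b - \<sigma>" for \<tau>
    unfolding quadratic_root_over_Qi[OF assms] by blast
  then show "galois_conjugate \<sigma> = - b - \<sigma>"
    unfolding galois_conjugate_def using ne by (intro the_equality) auto
  show "- b - \<sigma> \<notin> gaussian_rats"
  proof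
    assume "- b - \<sigma> \<in> gaussian_rats"
    then have "- b - (- b - \<sigma>) \<in> gaussian_rats"
      by (rule gaussian_rats_closed(7)[OF gaussian_rats_closed(10)[OF assms(2)]])
    then show False using assms(1) by simp
  qed
qed

text \<open>The conjugate polynomial has the reciprocal root \<open>cnj \<sigma> = 1 / \<sigma>\<close>, so by minimality it is
  proportional to the reversed polynomial; hence the constant term has modulus one.\<close>

lemma galois_conjugate_on_circle:
  assumes "norm \<sigma> = 1" "\<sigma> \<notin> gaussian_rats" "b \<in> gaussian_rats" "c \<in> gaussian_rats" "\<sigma>\<^sup>2 + b * \<sigma> + c = 0"
  shows "norm (- b - \<sigma>) = 1"
proof -
  have s0: "\<sigma> \<noteq> 0" using assms(1) by auto
  have c0: "c \<noteq> 0"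
  proof
    assume "c = 0"
    then have "\<sigma> * (\<sigma> + b) = 0" using assms(5) by (simp add: power2_eq_square algebra_simps)
    then have "\<sigma> = - b" using s0 by (simp add: add_eq_0_iff2)
    moreover have "- b \<in> gaussian_rats" using assms(3) by (intro gaussian_rats_closed)
    ultimately show False using assms(2) by simp
  qed
  have "cnj (\<sigma>\<^sup>2 + b * \<sigma> + c) = 0" using assms(5) by simp
  then have "(inverse \<sigma>)\<^sup>2 + cnj b * inverse \<sigma> + cnj c = 0" using cnj_unit[OF assms(1)] by simp
  then have "1 + cnj b * \<sigma> + cnj c * \<sigma>\<^sup>2 = 0" using s0 by (simp add: field_simps power2_eq_square)
  then have "\<sigma>\<^sup>2 + (cnj b / cnj c) * \<sigma> + 1 / cnj c = 0" using c0 by (simp add: field_simps)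
  moreover have "cnj b / cnj c \<in> gaussian_rats" "1 / cnj c \<in> gaussian_rats"
    using assms by (intro gaussian_rats_closed; simp)+
  ultimately have "[:c, b, 1:] = [:1 / cnj c, cnj b / cnj c, 1:]"
    using quadratic_root_over_Qi[OF assms(2)] assms(3-5) by blast
  then have "c * cnj c = 1" using c0 by (simp add: field_simps)
  then have "norm c ^ 2 = 1" by (metis complex_norm_square of_real_eq_1_iff)
  then have "norm c = 1" by (simp add: power2_eq_1_iff) (smt (verit) norm_ge_zero)
  have "\<sigma> * (- b - \<sigma>) = c" using assms(5) by algebra
  then have "norm \<sigma> * norm (- b - \<sigma>) = 1" using \<open>norm c = 1\<close> by (metis norm_mult)
  then show ?thesis using assms(1) by simp
qed

text \<open>Exchanging the two roots preserves the line of normals, so a rational vector on it is to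
  be expected; clearing denominators makes it integral.\<close>

lemma ex_int_normal:
  assumes "norm \<sigma> = 1" "\<sigma> \<notin> gaussian_rats" "b \<in> gaussian_rats" "c \<in> gaussian_rats" "\<sigma>\<^sup>2 + b * \<sigma> + c = 0"
  obtains V where "int_vec V" "lor V V > 0" "lor V (light \<sigma>) = 0" "lor V (light (- b - \<sigma>)) = 0"
proof -
  define \<rho> where "\<rho> = - b - \<sigma>"
  have r: "norm \<rho> = 1" "\<rho> \<noteq> \<sigma>" using galois_conjugate_on_circle[OF assms] galois_conjugate_eq[OF assms(2-)] by (auto simp: \<rho>_def)
  have nz: "\<sigma> \<noteq> 0" "\<rho> \<noteq> 0" using r assms by auto
  have "\<exists>V. Re (fst V) \<in> \<rat> \<and> Im (fst V) \<in> \<rat> \<and> snd V \<in> \<rat> \<and> lor V V > 0 \<and> lor V (light \<sigma>) = 0 \<and> lor V (light \<rho>) = 0"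
  proof (cases "b = 0")
    case False
    define d where "d = \<sigma> \<bullet> \<rho>"
    have sr: "\<sigma> + \<rho> = - b" by (simp add: \<rho>_def)
    have nb: "(norm b)\<^sup>2 = 2 + 2 * d"
    proof -
      have "(norm (\<sigma> + \<rho>))\<^sup>2 = (norm \<sigma>)\<^sup>2 + (norm \<rho>)\<^sup>2 + 2 * d"
        unfolding power2_norm_eq_inner d_def by (simp add: inner_add inner_commute)
      then show ?thesis using assms r sr by simp
    qed
    have "(norm b)\<^sup>2 = (Re b)\<^sup>2 + (Im b)\<^sup>2" by (simp add: cmod_power2)
    then have "d = ((Re b)\<^sup>2 + (Im b)\<^sup>2) / 2 - 1" using nb by (simp add: field_simps)
    then have drat: "d \<in> \<rat>" using assms(3) by (auto simp: gaussian_rats_iff)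
    have dpos: "1 + d > 0" using nb False by (smt (verit) zero_less_power zero_less_norm_iff)
    have dl: "d < 1" unfolding d_def using inner_unit_less_1[of \<sigma> \<rho>] assms r by auto
    \<comment> \<open>Each product with a light vector is \<open>1 + d - (1 + d)\<close>. The
      entries are rational since \<open>\<sigma> + \<rho> = - b\<close> and \<open>d\<close> is read
      off from \<open>(norm b)\<^sup>2\<close>.\<close>
    define V where "V = (\<sigma> + \<rho>, 1 + d)"
    have ss: "\<sigma> \<bullet> \<sigma> = 1" "\<rho> \<bullet> \<rho> = 1" using assms r by (simp_all add: power2_norm_eq_inner[symmetric])
    have "lor V V = 2 + 2 * d - (1 + d) * (1 + d)"
      using ss by (simp add: lor_def V_def inner_add d_def inner_commute)
    also have "\<dots> = (1 + d) * (1 - d)" by (simp add: algebra_simps)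
    finally have "lor V V > 0" using dpos dl by simp
    moreover have "lor V (light \<sigma>) = 0" "lor V (light \<rho>) = 0"
      using ss by (simp_all add: lor_def V_def light_def inner_add d_def inner_commute)
    moreover have "Re (fst V) \<in> \<rat>" "Im (fst V) \<in> \<rat>" "snd V \<in> \<rat>"
      using assms(3) drat unfolding V_def sr by (simp_all add: gaussian_rats_iff)
    ultimately show ?thesis by blast
  next
    \<comment> \<open>For antipodal points the previous vector vanishes. The normal
      \<open>\<i> * \<sigma>\<close> of the diameter becomes rational after a real scaling:
      \<open>1 - c = 1 + \<sigma>\<^sup>2\<close> is \<sigma> times twice its real part.\<close>
    case True
    have rs: "\<rho> = - \<sigma>" using True by (simp add: \<rho>_def)
    have c: "c = - (\<sigma>\<^sup>2)" using assms(5) True by (simp add: add_eq_0_iff)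
    define x where "x = Re \<sigma>"
    have e: "1 - c = \<sigma> * of_real (2 * x)"
    proof -
      have "1 - c = \<sigma> * (cnj \<sigma> + \<sigma>)" using nz cnj_unit[OF assms(1)] by (simp add: c power2_eq_square algebra_simps)
      also have "cnj \<sigma> + \<sigma> = of_real (2 * x)" by (simp add: x_def complex_eq_iff)
      finally show ?thesis .
    qed
    have "x \<noteq> 0"
    proof
      assume "x = 0"
      then have "\<sigma> = Im \<sigma> * \<i>" "\<bar>Im \<sigma>\<bar> = 1" using assms(1) by (auto simp: x_def complex_eq_iff cmod_def)
      then have "\<sigma> \<in> gaussian_rats" using \<open>x = 0\<close> by (auto simp: gaussian_rats_iff x_def abs_if split: if_splits)
      then show False using assms by simp
    qed
    define V :: "complex \<times> real" where "V = (\<i> * (1 - c), 0)"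
    have V: "V = ((2 * x) *\<^sub>R (\<i> * \<sigma>), 0)" by (simp add: V_def e scaleR_conv_of_real)
    have i: "(\<i> * \<sigma>) \<bullet> \<sigma> = 0" "(\<i> * \<sigma>) \<bullet> (\<i> * \<sigma>) = 1"
      using assms(1) by (simp_all add: inner_complex_def) (simp add: cmod_def power2_eq_square algebra_simps)
    have "lor V V > 0" using i \<open>x \<noteq> 0\<close> by (simp add: V lor_def) (auto simp: zero_less_mult_iff)
    moreover have "lor V (light \<sigma>) = 0" "lor V (light \<rho>) = 0"
      using i by (simp_all add: V lor_def light_def rs)
    moreover have "\<i> * (1 - c) \<in> gaussian_rats" using assms(4) by (intro gaussian_rats_closed)
    then have "Re (fst V) \<in> \<rat>" "Im (fst V) \<in> \<rat>" "snd V \<in> \<rat>"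
      unfolding V_def by (simp_all only: gaussian_rats_iff fst_conv snd_conv Rats_0)
    ultimately show ?thesis by blast
  qed
  then obtain V where V: "Re (fst V) \<in> \<rat>" "Im (fst V) \<in> \<rat>" "snd V \<in> \<rat>" "lor V V > 0" "lor V (light \<sigma>) = 0" "lor V (light \<rho>) = 0"
    by blast
  obtain N where "N > 0" "int_vec (N *\<^sub>R V)" using ex_int_multiple V by blast
  then show thesis using V that[of "N *\<^sub>R V"] by (simp add: \<rho>_def)
qed

section \<open>Driving a second point by the itinerary of the first\<close>

definition gaussian_moebius :: "(complex \<Rightarrow> complex) \<Rightarrow> bool" where
  "gaussian_moebius f \<longleftrightarrow> (\<exists>a\<in>gaussian_rats. \<exists>b\<in>gaussian_rats. \<exists>c\<in>gaussian_rats. \<exists>d\<in>gaussian_rats.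
     \<forall>z. norm z = 1 \<longrightarrow> c * z + d \<noteq> 0 \<and> f z = (a * z + b) / (c * z + d))"

lemma gaussian_moebius_id: "gaussian_moebius (\<lambda>z. z)"
  unfolding gaussian_moebius_def
  by (intro bexI[of _ 1] bexI[of _ 0]) (auto simp: gaussian_rats_closed)

text \<open>Coefficients multiply like matrices; as \<open>g\<close> preserves the circle, the
  denominator of \<open>f\<close> stays nonzero.\<close>

lemma gaussian_moebius_comp:
  assumes "gaussian_moebius f" "gaussian_moebius g" "\<And>z. norm z = 1 \<Longrightarrow> norm (g z) = 1"
  shows "gaussian_moebius (\<lambda>z. f (g z))"
proof -
  obtain a b c d where f: "a \<in> gaussian_rats" "b \<in> gaussian_rats" "c \<in> gaussian_rats" "d \<in> gaussian_rats"
    "\<And>z. norm z = 1 \<Longrightarrow> c * z + d \<noteq> 0 \<and> f z = (a * z + b) / (c * z + d)"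
    using assms(1) unfolding gaussian_moebius_def by blast
  obtain a' b' c' d' where g: "a' \<in> gaussian_rats" "b' \<in> gaussian_rats" "c' \<in> gaussian_rats" "d' \<in> gaussian_rats"
    "\<And>z. norm z = 1 \<Longrightarrow> c' * z + d' \<noteq> 0 \<and> g z = (a' * z + b') / (c' * z + d')"
    using assms(2) unfolding gaussian_moebius_def by blast
  have "(c * a' + d * c') * z + (c * b' + d * d') \<noteq> 0 \<and>
     f (g z) = ((a * a' + b * c') * z + (a * b' + b * d')) / ((c * a' + d * c') * z + (c * b' + d * d'))"
    if z: "norm z = 1" for z
  proof -
    define n where "n = c' * z + d'"
    have n: "n \<noteq> 0" "a' * z + b' = g z * n" using g(5)[OF z] by (auto simp: n_def)
    have gz: "c * g z + d \<noteq> 0" "f (g z) = (a * g z + b) / (c * g z + d)" using f(5)[OF assms(3)[OF z]] by auto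
    have "(c * a' + d * c') * z + (c * b' + d * d') = c * (a' * z + b') + d * n"
      by (simp add: n_def algebra_simps)
    then have e1: "(c * a' + d * c') * z + (c * b' + d * d') = (c * g z + d) * n" unfolding n(2) by (simp add: algebra_simps)
    have "(a * a' + b * c') * z + (a * b' + b * d') = a * (a' * z + b') + b * n"
      by (simp add: n_def algebra_simps)
    then have e2: "(a * a' + b * c') * z + (a * b' + b * d') = (a * g z + b) * n" unfolding n(2) by (simp add: algebra_simps)
    show ?thesis unfolding e1 e2 using n gz by simp
  qed
  then show ?thesis unfolding gaussian_moebius_def
    using f(1-4) g(1-4)
    by (intro bexI[of _ "a * a' + b * c'"] bexI[of _ "a * b' + b * d'"] bexI[of _ "c * a' + d * c'"] bexI[of _ "c * b' + d * d'"])
      (auto intro!: gaussian_rats_closed)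
qed

text \<open>Cross-multiplied, \<open>f z = g z\<close> is a polynomial equation of degree at most
  two over Q(i). The point \<open>y\<close> shows that it is not an identity, and \<sigma> outside
  Q(i) excludes degree one.\<close>

lemma coincidence_quadratic:
  assumes f: "gaussian_moebius f" and g: "gaussian_moebius g"
    and "norm \<sigma> = 1" "\<sigma> \<notin> gaussian_rats" "f \<sigma> = g \<sigma>" "norm y = 1" "f y \<noteq> g y"
  shows "quadratic_over_Qi \<sigma>"
proof -
  obtain a b c d where f: "a \<in> gaussian_rats" "b \<in> gaussian_rats" "c \<in> gaussian_rats" "d \<in> gaussian_rats"
    "\<And>z. norm z = 1 \<Longrightarrow> c * z + d \<noteq> 0 \<and> f z = (a * z + b) / (c * z + d)"
    using f unfolding gaussian_moebius_def by blast
  obtain a' b' c' d' where g: "a' \<in> gaussian_rats" "b' \<in> gaussian_rats" "c' \<in> gaussian_rats" "d' \<in> gaussian_rats"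
    "\<And>z. norm z = 1 \<Longrightarrow> c' * z + d' \<noteq> 0 \<and> g z = (a' * z + b') / (c' * z + d')"
    using g unfolding gaussian_moebius_def by blast
  define A where "A = a * c' - a' * c"
  define M where "M = a * d' + b * c' - a' * d - b' * c"
  define N where "N = b * d' - b' * d"
  have Q: "A \<in> gaussian_rats" "M \<in> gaussian_rats" "N \<in> gaussian_rats"
    unfolding A_def M_def N_def using f(1-4) g(1-4) by (auto intro!: gaussian_rats_closed)
  have e: "f z = g z \<longleftrightarrow> A * z\<^sup>2 + M * z + N = 0" if z: "norm z = 1" for z
  proof -
    have "f z = g z \<longleftrightarrow> (a * z + b) * (c' * z + d') = (a' * z + b') * (c * z + d)"
      using f(5)[OF z] g(5)[OF z] by (auto simp: frac_eq_eq)
    also have "\<dots> \<longleftrightarrow> (a * z + b) * (c' * z + d') - (a' * z + b') * (c * z + d) = 0" by simp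
    also have "(a * z + b) * (c' * z + d') - (a' * z + b') * (c * z + d) = A * z\<^sup>2 + M * z + N"
      by (simp add: A_def M_def N_def power2_eq_square algebra_simps)
    finally show ?thesis .
  qed
  have 1: "A * \<sigma>\<^sup>2 + M * \<sigma> + N = 0" using e assms by blast
  have 2: "A * y\<^sup>2 + M * y + N \<noteq> 0" using e assms by blast
  have "A \<noteq> 0"
  proof
    assume A: "A = 0"
    then have "M \<noteq> 0" using 1 2 by auto
    then have "\<sigma> = - N / M" using 1 A by (simp add: field_simps add_eq_0_iff2)
    moreover have "- N / M \<in> gaussian_rats" using Q by (intro gaussian_rats_closed)
    ultimately show False using assms(4) by simp
  qed
  then have "\<sigma>\<^sup>2 + (M / A) * \<sigma> + N / A = 0" using 1 by (simp add: field_simps)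
  moreover have "M / A \<in> gaussian_rats" "N / A \<in> gaussian_rats" using Q by (intro gaussian_rats_closed; simp)+
  ultimately show ?thesis unfolding quadratic_over_Qi_iff using assms(4) by blast
qed

context partition
begin

section \<open>The driven orbit\<close>

lemma R_moebius: 
  assumes "a < m" shows "gaussian_moebius (R a)"
proof -
  have "2 * z - (P a + Q a) \<noteq> 0" if z: "norm z = 1" for z
    by (rule circle_reflection_denominator) (use assms P_neq_Q z in auto)
  then have "\<forall>z. norm z = 1 \<longrightarrow> 2 * z + - (P a + Q a) \<noteq> 0 \<and>
     R a z = ((P a + Q a) * z + - 2 * P a * Q a) / (2 * z + - (P a + Q a))"
    unfolding circle_reflection_def add_uminus_conv_diff by simp
  moreover have "P a + Q a \<in> gaussian_rats" "- 2 * P a * Q a \<in> gaussian_rats" "2 \<in> gaussian_rats" "- (P a + Q a) \<in> gaussian_rats"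
    by (intro gaussian_rats_closed P_gauss)+
  ultimately show ?thesis unfolding gaussian_moebius_def by blast
qed

text \<open>For fixed \<sigma> and \<open>n\<close> this is a single Moebius map in \<rho>, unlike
  the iterate of \<open>B\<close>, whose branch varies with the point.\<close>

primrec codriven :: "complex \<Rightarrow> complex \<Rightarrow> nat \<Rightarrow> complex" where
  "codriven \<sigma> \<rho> 0 = \<rho>"
| "codriven \<sigma> \<rho> (Suc n) = R (idx ((B ^^ n) \<sigma>)) (codriven \<sigma> \<rho> n)"

lemma symbolic_snth: "symbolic_seq m t \<sigma> !! n = idx ((B ^^ n) \<sigma>)"
  by (simp add: symbolic_seq_def)

lemma B_pow_add: "(B ^^ (n + k)) \<sigma> = (B ^^ k) ((B ^^ n) \<sigma>)"
  by (metis add.commute comp_apply funpow_add)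

lemma codriven_self: "codriven \<sigma> \<sigma> n = (B ^^ n) \<sigma>"
  by (induction n) (auto simp: B_eq[of "(B ^^ _) _"])

lemma codriven_irr: "irr \<sigma> \<Longrightarrow> irr \<rho> \<Longrightarrow> irr (codriven \<sigma> \<rho> n)"
  by (induction n) (auto intro!: irr_R idx_less)

lemma codriven_norm: "norm \<sigma> = 1 \<Longrightarrow> norm \<rho> = 1 \<Longrightarrow> norm (codriven \<sigma> \<rho> n) = 1"
  by (induction n) auto

lemma codriven_neq:
  assumes "norm \<sigma> = 1" "norm \<rho> = 1" "\<sigma> \<noteq> \<rho>"
  shows "(B ^^ n) \<sigma> \<noteq> codriven \<sigma> \<rho> n"
proof (induction n)
  case (Suc n)
  show ?case
  proof
    assume "(B ^^ Suc n) \<sigma> = codriven \<sigma> \<rho> (Suc n)"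
    then have "R (idx ((B ^^ n) \<sigma>)) (R (idx ((B ^^ n) \<sigma>)) ((B ^^ n) \<sigma>)) =
      R (idx ((B ^^ n) \<sigma>)) (R (idx ((B ^^ n) \<sigma>)) (codriven \<sigma> \<rho> n))" by (simp add: B_eq)
    then show False using Suc assms codriven_norm by simp
  qed
qed (use assms in simp)

text \<open>Undoing the reflections in reverse order allows the driven point to be prescribed at a
  given time.\<close>

lemma codriven_surj:
  assumes "norm \<sigma> = 1" "norm z = 1"
  shows "\<exists>y. norm y = 1 \<and> codriven \<sigma> y n = z"
  using assms(2)
proof (induction n arbitrary: z)
  case (Suc n)
  then obtain y where "norm y = 1" "codriven \<sigma> y n = R (idx ((B ^^ n) \<sigma>)) z"
    using assms(1) by (metis B_pow_norm R_norm idx_less)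
  then show ?case using Suc.prems assms by (intro exI[of _ y]) simp
qed auto

lemma codriven_moebius:
  assumes "norm \<sigma> = 1"
  shows "gaussian_moebius (\<lambda>y. codriven \<sigma> y n)"
proof (induction n)
  case 0
  then show ?case by (simp add: gaussian_moebius_id)
next
  case (Suc n)
  then show ?case using gaussian_moebius_comp[OF R_moebius Suc] assms codriven_norm by simp
qed

lemma codriven_back:
  assumes "norm \<sigma> = 1" "norm \<rho> = 1"
  shows "codriven \<sigma> \<rho> n = R (idx ((B ^^ n) \<sigma>)) (codriven \<sigma> \<rho> (Suc n))"
  using assms codriven_norm by simp

lemma idx_B_neq: "nonvertex z \<Longrightarrow> idx (B z) \<noteq> idx z"
  using idx_R_neq by (simp add: nonvertex_def B_eq)

text \<open>With \<open>a\<close> the arc of the first point, the reflection takes the driven point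
  into \<open>a\<close>, while \<open>B\<close> expels the first point from it. So the arcs differ
  again, and \<open>B\<close> undoes the step on the driven point.\<close>

lemma codriven_apart_step:
  assumes "nonvertex ((B ^^ n) \<sigma>)" "nonvertex (codriven \<sigma> \<rho> n)" "idx (codriven \<sigma> \<rho> n) \<noteq> idx ((B ^^ n) \<sigma>)"
  shows "nonvertex (codriven \<sigma> \<rho> (Suc n))" "idx (codriven \<sigma> \<rho> (Suc n)) = idx ((B ^^ n) \<sigma>)"
    "B (codriven \<sigma> \<rho> (Suc n)) = codriven \<sigma> \<rho> n"
    "idx (codriven \<sigma> \<rho> (Suc n)) \<noteq> idx ((B ^^ Suc n) \<sigma>)"
  using nonvertex_R[OF assms(2) _ assms(3)[symmetric, THEN not_sym]] assms(1) idx_B_neq[OF assms(1)]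
  by (auto simp: nonvertex_def)

lemma codriven_apart:
  assumes "\<And>n. nonvertex ((B ^^ n) \<sigma>)" "nonvertex (codriven \<sigma> \<rho> h)" "idx (codriven \<sigma> \<rho> h) \<noteq> idx ((B ^^ h) \<sigma>)" "n \<ge> h"
  shows "nonvertex (codriven \<sigma> \<rho> n) \<and> idx (codriven \<sigma> \<rho> n) \<noteq> idx ((B ^^ n) \<sigma>)"
  using assms(4)
proof (induction n rule: dec_induct)
  case (step n)
  then show ?case using codriven_apart_step[OF assms(1)] by blast
qed (use assms in simp)

lemma irr_nonvertex_orbit: "irr \<sigma> \<Longrightarrow> nonvertex ((B ^^ n) \<sigma>)"
  by (simp add: irr_B_pow irr_nonvertex)

section \<open>Splitting of two itineraries and reversal\<close>

lemma ex_split: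
  assumes "irr \<sigma>" "irr \<rho>" "\<sigma> \<noteq> \<rho>"
  shows "\<exists>n. idx ((B ^^ n) \<sigma>) \<noteq> idx ((B ^^ n) \<rho>)"
  using itinerary_inj[of \<sigma> \<rho>] irr_nonvertex_orbit assms by blast

definition split_time :: "complex \<Rightarrow> complex \<Rightarrow> nat" where
  "split_time \<sigma> \<rho> = (LEAST n. idx ((B ^^ n) \<sigma>) \<noteq> idx ((B ^^ n) \<rho>))"

lemma before_split: "n < split_time \<sigma> \<rho> \<Longrightarrow> idx ((B ^^ n) \<sigma>) = idx ((B ^^ n) \<rho>)"
  unfolding split_time_def using not_less_Least by blast

text \<open>While the arcs agree, the reflection chosen by \<sigma> is the one that \<open>B\<close>
  applies to \<rho>.\<close>

lemma codriven_before_split: "n \<le> split_time \<sigma> \<rho> \<Longrightarrow> codriven \<sigma> \<rho> n = (B ^^ n) \<rho>"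
proof (induction n)
  case (Suc n)
  then show ?case using before_split[of n \<sigma> \<rho>] by (simp add: B_eq[of "(B ^^ n) \<rho>"])
qed simp

lemma codriven_after_split:
  assumes "irr \<sigma>" "irr \<rho>" "\<sigma> \<noteq> \<rho>" "n \<ge> split_time \<sigma> \<rho>"
  shows "idx (codriven \<sigma> \<rho> n) \<noteq> idx ((B ^^ n) \<sigma>)"
proof -
  have "idx ((B ^^ split_time \<sigma> \<rho>) \<sigma>) \<noteq> idx ((B ^^ split_time \<sigma> \<rho>) \<rho>)"
    using LeastI_ex[OF ex_split[OF assms(1-3)]] unfolding split_time_def .
  then have "idx (codriven \<sigma> \<rho> (split_time \<sigma> \<rho>)) \<noteq> idx ((B ^^ split_time \<sigma> \<rho>) \<sigma>)"
    by (simp add: codriven_before_split)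
  then show ?thesis
    using codriven_apart[of \<sigma> \<rho> "split_time \<sigma> \<rho>" n] assms irr_nonvertex_orbit irr_nonvertex codriven_irr by blast
qed

lemma codriven_after_split_step:
  assumes "irr \<sigma>" "irr \<rho>" "\<sigma> \<noteq> \<rho>" "n \<ge> split_time \<sigma> \<rho>"
  shows "idx (codriven \<sigma> \<rho> (Suc n)) = idx ((B ^^ n) \<sigma>)" "B (codriven \<sigma> \<rho> (Suc n)) = codriven \<sigma> \<rho> n"
  using codriven_apart_step[of n \<sigma> \<rho>] codriven_after_split[OF assms] assms
    irr_nonvertex_orbit irr_nonvertex codriven_irr by blast+

lemma split_time_0_iff:
  assumes "irr \<sigma>" "irr \<rho>" "\<sigma> \<noteq> \<rho>"
  shows "split_time \<sigma> \<rho> = 0 \<longleftrightarrow> idx \<sigma> \<noteq> idx \<rho>"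
proof
  show "split_time \<sigma> \<rho> = 0 \<Longrightarrow> idx \<sigma> \<noteq> idx \<rho>"
    using codriven_after_split[OF assms, of 0] by simp
  show "idx \<sigma> \<noteq> idx \<rho> \<Longrightarrow> split_time \<sigma> \<rho> = 0"
    unfolding split_time_def by (rule Least_eq_0) simp
qed

text \<open>Periodicity of the pair identifies the driven points at times \<open>h\<close> and
  \<open>h + p\<close>, so the \<open>B\<close>-orbit of \<rho> after time \<open>h\<close> descends
  through the driven orbit from \<open>h + p\<close>. The last claim makes the common preperiod
  \<open>u\<close> minimal for both sequences.\<close>

lemma reversal:
  assumes "irr \<sigma>" "irr \<rho>" "\<sigma> \<noteq> \<rho>" and h: "h = split_time \<sigma> \<rho>" and p: "p > 0"
    and per: "(B ^^ (h + p)) \<sigma> = (B ^^ h) \<sigma>" "codriven \<sigma> \<rho> (h + p) = codriven \<sigma> \<rho> h"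
  defines "u \<equiv> stake h (symbolic_seq m t \<sigma>)" and "v \<equiv> stake p (sdrop h (symbolic_seq m t \<sigma>))"
  shows "symbolic_seq m t \<sigma> = u @- cycle v" "symbolic_seq m t \<rho> = u @- cycle (rev v)"
    "u \<noteq> [] \<Longrightarrow> last u \<noteq> last v \<and> last u \<noteq> last (rev v)"
proof -
  let ?s = "symbolic_seq m t \<sigma>" and ?r = "symbolic_seq m t \<rho>"
  have shift: "(B ^^ (n + p)) x = (B ^^ n) x" if "n \<ge> h" "(B ^^ (h + p)) x = (B ^^ h) x" for n x
  proof -
    have "(B ^^ (n + p)) x = (B ^^ (n - h)) ((B ^^ (h + p)) x)"
      using that(1) B_pow_add[of "h + p" "n - h" x] by (simp add: algebra_simps)
    then show ?thesis using that B_pow_add[of h "n - h" x] by simp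
  qed
  show s: "?s = u @- cycle v"
    unfolding u_def v_def by (rule stream_periodicI[OF p]) (simp add: symbolic_snth shift[OF _ per(1)])
  have unwind: "(B ^^ j) (codriven \<sigma> \<rho> (n + j)) = codriven \<sigma> \<rho> n" if "n \<ge> h" for n j
  proof (induction j)
    case (Suc j)
    have "B (codriven \<sigma> \<rho> (Suc (n + j))) = codriven \<sigma> \<rho> (n + j)"
      using codriven_after_split_step[OF assms(1-3), of "n + j"] that h by simp
    then show ?case using Suc by (simp add: funpow_swap1 del: codriven.simps funpow.simps) (simp add: funpow_swap1 del: codriven.simps)
  qed simp
  have rh: "(B ^^ h) \<rho> = codriven \<sigma> \<rho> h" using codriven_before_split[of h \<sigma> \<rho>] h by simp
  have rj: "(B ^^ (h + j)) \<rho> = codriven \<sigma> \<rho> (h + p - j)" if "j \<le> p" for j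
  proof -
    have "(B ^^ (h + j)) \<rho> = (B ^^ j) (codriven \<sigma> \<rho> (h + p))" unfolding B_pow_add rh per(2) ..
    also have "\<dots> = codriven \<sigma> \<rho> (h + p - j)" using unwind[of "h + p - j" j] that by simp
    finally show ?thesis .
  qed
  have "(B ^^ (h + p)) \<rho> = (B ^^ h) \<rho>" using rj[of p] rh by simp
  then have r: "?r = stake h ?r @- cycle (stake p (sdrop h ?r))"
    by (intro stream_periodicI[OF p]) (simp add: symbolic_snth shift)
  have "stake h ?r = u" unfolding u_def
    by (rule nth_equalityI) (use h in \<open>auto simp: symbolic_snth before_split\<close>)
  moreover have "stake p (sdrop h ?r) = rev v"
  proof (rule nth_equalityI)
    fix j assume "j < length (stake p (sdrop h ?r))"
    then have j: "j < p" by simp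
    have "stake p (sdrop h ?r) ! j = idx (codriven \<sigma> \<rho> (h + p - j))"
      using j rj[of j] by (simp add: sdrop_snth symbolic_snth)
    \<comment> \<open>Shift by one: the driven point at time \<open>Suc k\<close> lies in the arc
      that \<sigma> occupies at time \<open>k\<close>, so the reversed word starts at time
      \<open>h + p - 1\<close>.\<close>
    also have "h + p - j = Suc (h + (p - Suc j))" using j by simp
    also have "idx (codriven \<sigma> \<rho> (Suc (h + (p - Suc j)))) = idx ((B ^^ (h + (p - Suc j))) \<sigma>)"
      using codriven_after_split_step[OF assms(1-3)] h by simp
    also have "\<dots> = rev v ! j" using j by (simp add: v_def rev_nth sdrop_snth symbolic_snth)
    finally show "stake p (sdrop h ?r) ! j = rev v ! j" .
  qed (simp add: v_def)
  ultimately show "?r = u @- cycle (rev v)" using r by simp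
  assume "u \<noteq> []"
  then have h0: "h > 0" by (auto simp: u_def)
  have lu: "last u = idx ((B ^^ (h - 1)) \<sigma>)"
    using h0 by (simp add: u_def last_conv_nth symbolic_snth)
  have lv: "last v = idx ((B ^^ (h + (p - 1))) \<sigma>)" "hd v = idx ((B ^^ h) \<sigma>)"
  proof -
    have "v \<noteq> []" using p by (metis v_def length_stake list.size(3) less_irrefl)
    then show "last v = idx ((B ^^ (h + (p - 1))) \<sigma>)" "hd v = idx ((B ^^ h) \<sigma>)"
      using p by (simp_all add: v_def last_conv_nth hd_conv_nth sdrop_snth symbolic_snth)
  qed
  have e: "codriven \<sigma> \<rho> h = B ((B ^^ (h - 1)) \<rho>)" "(B ^^ h) \<sigma> = B ((B ^^ (h - 1)) \<sigma>)"
    using rh h0 by (simp_all flip: funpow.simps(2)[THEN fun_cong, simplified comp_def])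
  \<comment> \<open>The driven point at \<open>h + p\<close>, hence at \<open>h\<close>, lies in the
    arc named by the last letter of \<open>v\<close>. Just before the split both orbits share an arc
    and both leave it in the next step, which separates \<open>last u\<close> from both ends of
    \<open>v\<close>.\<close>
  have "idx (codriven \<sigma> \<rho> h) = idx ((B ^^ (h + (p - 1))) \<sigma>)"
    using codriven_after_split_step(1)[OF assms(1-3), of "h + (p - 1)"] per(2) h p by (simp del: codriven.simps)
  moreover have "idx (codriven \<sigma> \<rho> h) \<noteq> idx ((B ^^ (h - 1)) \<rho>)"
    unfolding e by (intro idx_B_neq irr_nonvertex_orbit assms)
  moreover have "idx ((B ^^ (h - 1)) \<rho>) = idx ((B ^^ (h - 1)) \<sigma>)"
    using before_split[of "h - 1" \<sigma> \<rho>] h h0 by simp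
  moreover have "idx ((B ^^ h) \<sigma>) \<noteq> idx ((B ^^ (h - 1)) \<sigma>)"
    unfolding e by (intro idx_B_neq irr_nonvertex_orbit assms)
  ultimately show "last u \<noteq> last v \<and> last u \<noteq> last (rev v)"
    unfolding last_rev lu lv by simp
qed

section \<open>Finiteness of separating normals and periodicity of pairs\<close>

lemma finite_int_box: "finite {x :: real. x \<in> \<int> \<and> \<bar>x\<bar> \<le> M}"
  using finite_abs_int_segment[of M] by simp

text \<open>In the basis adapted to side \<open>a\<close> the norm reads
  \<open>D = 2 * (- (x * y)) / G + z * z\<close> with integer coordinates. Separation makes both
  terms nonnegative, so all three integers are bounded, and they determine \<open>V\<close>.\<close>

lemma finite_separating:
  assumes a: "a < m" and D: "D > 0"
  shows "finite {V. int_vec V \<and> lor V V = D \<and> lor V (light (P a)) * lor V (light (Q a)) < 0}" (is "finite ?F")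
proof -
  have d: "norm (P a) = 1" "norm (Q a) = 1" "P a \<noteq> Q a" using a P_neq_Q by auto
  define p q where "p = real_of_int (t a $ 3)" and "q = real_of_int (t (Suc a mod m) $ 3)"
  have pq: "p > 0" "q > 0" using t3_pos[of a] t3_pos[of "Suc a mod m"] a by (auto simp: p_def q_def)
  have T: "int_vec (p *\<^sub>R light (P a))" "int_vec (q *\<^sub>R light (Q a))"
    using int_vec_triple T_eq[of a] T_eq[of "Suc a mod m"] a by (metis p_def m0 mod_less_divisor q_def)+
  define g where "g = lor (light (P a)) (light (Q a))"
  have g: "g < 0" unfolding g_def by (rule light_P_Q_neg[OF a])
  define G where "G = - (p * q * g)"
  have G: "G > 0" using pq g by (simp add: G_def mult_pos_neg)
  define f where "f V = (lor V (p *\<^sub>R light (P a)), lor V (q *\<^sub>R light (Q a)), lor V (w a))" for V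
  have "inj_on f ?F"
  proof (rule inj_onI)
    fix V W assume "f V = f W"
    then have "lor V (light (P a)) = lor W (light (P a))" "lor V (light (Q a)) = lor W (light (Q a))" "lor V (w a) = lor W (w a)"
      using pq by (auto simp: f_def)
    then have "lor V y = lor W y" for y
      using lor_decomposition[OF d, of V y] lor_decomposition[OF d, of W y] by simp
    then show "V = W" by (rule lor_nondegenerate)
  qed
  moreover have "f ` ?F \<subseteq> {x. x \<in> \<int> \<and> \<bar>x\<bar> \<le> D * G} \<times> {x. x \<in> \<int> \<and> \<bar>x\<bar> \<le> D * G} \<times> {x. x \<in> \<int> \<and> \<bar>x\<bar> \<le> D}"
  proof (rule image_subsetI)
    fix V assume "V \<in> ?F"
    then have V: "int_vec V" "lor V V = D" "lor V (light (P a)) * lor V (light (Q a)) < 0" by auto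
    define x y z where "x = lor V (p *\<^sub>R light (P a))" and "y = lor V (q *\<^sub>R light (Q a))" and "z = lor V (w a)"
    have Z: "x \<in> \<int>" "y \<in> \<int>" "z \<in> \<int>" unfolding x_def y_def z_def by (intro lor_int V T w_int a)+
    have xy: "x * y = (p * q) * (lor V (light (P a)) * lor V (light (Q a)))" by (simp add: x_def y_def)
    have neg: "x * y < 0" unfolding xy by (rule mult_pos_neg[OF mult_pos_pos[OF pq] V(3)])
    have "D = 2 * (lor V (light (P a)) * lor V (light (Q a))) / g + z * z"
      using lor_decomposition[OF d, of V V] V(2) by (simp add: g_def z_def)
    also have "2 * (lor V (light (P a)) * lor V (light (Q a))) / g = 2 * (- (x * y)) / G"
      unfolding xy G_def using pq g by (simp add: field_simps)
    finally have De: "D = 2 * (- (x * y)) / G + z * z" .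
    have zz: "z * z \<le> D" using De neg G by (simp add: divide_nonneg_pos) (smt (verit) divide_neg_pos)
    \<comment> \<open>A nonzero integer factor has modulus at least one, so a bound on
      \<open>x * y\<close> bounds each factor.\<close>
    have ge1: "\<bar>k\<bar> \<le> \<bar>k * l\<bar>" if "l \<in> \<int>" "l \<noteq> 0" for k l :: real
    proof -
      have "\<bar>l\<bar> \<ge> 1" using that by (rule Ints_nonzero_abs_ge1)
      then show ?thesis using mult_left_mono[of 1 "\<bar>l\<bar>" "\<bar>k\<bar>"] by (simp add: abs_mult)
    qed
    have "z * z \<ge> 0" by simp
    then have "2 * (- (x * y)) / G \<le> D" using De by linarith
    then have "2 * (- (x * y)) \<le> D * G" using pos_divide_le_eq[OF G] by blast
    then have "\<bar>x * y\<bar> \<le> D * G" using neg by simp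
    moreover have "x \<noteq> 0" "y \<noteq> 0" using neg by auto
    ultimately have "\<bar>x\<bar> \<le> D * G" "\<bar>y\<bar> \<le> D * G"
      using ge1[OF Z(2), of x] ge1[OF Z(1), of y] by (auto simp: mult.commute)
    moreover have "\<bar>z\<bar> \<le> D"
    proof (cases "z = 0")
      case False
      then show ?thesis using ge1[OF Z(3), of z] zz by simp
    qed (use D in simp)
    ultimately show "f V \<in> {x. x \<in> \<int> \<and> \<bar>x\<bar> \<le> D * G} \<times> {x. x \<in> \<int> \<and> \<bar>x\<bar> \<le> D * G} \<times> {x. x \<in> \<int> \<and> \<bar>x\<bar> \<le> D}"
      using Z by (simp add: f_def x_def y_def z_def)
  qed
  then have "finite (f ` ?F)"
    by (rule finite_subset) (intro finite_cartesian_product finite_int_box)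
  ultimately show ?thesis by (rule finite_imageD[rotated])
qed

text \<open>If \<open>V\<close> had weakly constant sign on the two vertices of the arc containing \<open>z\<close> but not \<open>r\<close>, then
  \<open>lor V (w a)\<close> would have to be both nonnegative and nonpositive.\<close>

lemma separating:
  assumes "nonvertex z" "nonvertex r" "idx z = a" "idx r \<noteq> a"
    and "lor V (light z) = 0" "lor V (light r) = 0" "lor V V > 0"
  shows "lor V (light (P a)) * lor V (light (Q a)) < 0"
proof (rule ccontr)
  assume neg: "\<not> ?thesis"
  have n: "norm z = 1" "norm r = 1" using assms by (auto simp: nonvertex_def)
  have a: "a < m" using assms n by auto
  have d: "norm (P a) = 1" "norm (Q a) = 1" "P a \<noteq> Q a" using a P_neq_Q by auto
  define g where "g = lor (light (P a)) (light (Q a))"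
  have g: "g < 0" unfolding g_def by (rule light_P_Q_neg[OF a])
  have no: False if W: "lor W (light (P a)) \<ge> 0" "lor W (light (Q a)) \<ge> 0"
    "lor W (light z) = 0" "lor W (light r) = 0" "lor W W > 0" for W
  proof -
    define S where "S y = (lor y (light (Q a)) * lor W (light (P a)) + lor y (light (P a)) * lor W (light (Q a))) / g" for y
    have dec: "lor y W = S y + lor y (w a) * lor W (w a)" for y
      using lor_decomposition[OF d, of y W] by (simp add: g_def S_def)
    have S: "S (light y) \<ge> 0" if "nonvertex y" for y
      unfolding S_def using nonvertex_neg[OF that, of a] nonvertex_neg[OF that, of "Suc a mod m"] a W(1,2) g
      by (intro divide_nonpos_neg add_nonpos_nonpos mult_nonpos_nonneg) auto
    have "lor (light z) (w a) > 0" using w_pos_iff[OF n(1) a] assms by (simp add: nonvertex_def lor_commute)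
    moreover have "S (light z) + lor (light z) (w a) * lor W (w a) = 0" using dec[of "light z"] W by (simp add: lor_commute)
    ultimately have 1: "lor W (w a) \<le> 0" using S[OF assms(1)] by (smt (verit) mult_pos_pos)
    have "lor (w a) (light r) \<noteq> 0" using w_zero_iff[OF n(2) a] nonvertex_neq[OF assms(2)] a by auto
    then have "lor (light r) (w a) < 0" using w_pos_iff[OF n(2) a] assms by (simp add: lor_commute)
    moreover have Sr: "S (light r) + lor (light r) (w a) * lor W (w a) = 0" using dec[of "light r"] W by (simp add: lor_commute)
    ultimately have "lor W (w a) \<ge> 0" using S[OF assms(2)] by (smt (verit) mult_neg_neg)
    then have w0: "lor W (w a) = 0" using 1 by simp
    then have "S (light r) = 0" using Sr by simp
    then have z0: "lor (light r) (light (Q a)) * lor W (light (P a)) + lor (light r) (light (P a)) * lor W (light (Q a)) = 0"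
      using g by (simp add: S_def)
    have rn: "lor (light r) (light (Q a)) < 0" "lor (light r) (light (P a)) < 0"
      using nonvertex_neg[OF assms(2)] a by auto
    have "lor (light r) (light (Q a)) * lor W (light (P a)) \<le> 0" "lor (light r) (light (P a)) * lor W (light (Q a)) \<le> 0"
      using rn W by (simp_all add: mult_nonpos_nonneg)
    then have "lor (light r) (light (Q a)) * lor W (light (P a)) = 0" "lor (light r) (light (P a)) * lor W (light (Q a)) = 0"
      using z0 by linarith+
    then have "lor W (light (P a)) = 0" "lor W (light (Q a)) = 0" using rn by auto
    then have "lor W W = 0" using lor_decomposition[OF d, of W W] w0 by simp
    then show False using W(5) by simp
  qed
  have "lor V (light (P a)) * lor V (light (Q a)) \<ge> 0" using neg by simp
  then consider "lor V (light (P a)) \<ge> 0" "lor V (light (Q a)) \<ge> 0" | "lor V (light (P a)) \<le> 0" "lor V (light (Q a)) \<le> 0"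
    by (auto simp: zero_le_mult_iff)
  then show False
  proof cases
    case 1
    then show ?thesis using no[of V] assms by simp
  next
    case 2
    then show ?thesis using no[of "- V"] assms by simp
  qed
qed

primrec codriven_vec :: "complex \<Rightarrow> complex \<times> real \<Rightarrow> nat \<Rightarrow> complex \<times> real" where
  "codriven_vec \<sigma> V 0 = V"
| "codriven_vec \<sigma> V (Suc n) = refl_vec (w (idx ((B ^^ n) \<sigma>))) (codriven_vec \<sigma> V n)"

lemma codriven_vec_perp:
  assumes "norm \<sigma> = 1" "norm \<rho> = 1" "lor V (light \<rho>) = 0"
  shows "lor (codriven_vec \<sigma> V n) (light (codriven \<sigma> \<rho> n)) = 0"
  by (induction n) (auto intro!: perp_R simp: assms codriven_norm)

lemma codriven_vec_norm: "norm \<sigma> = 1 \<Longrightarrow> lor (codriven_vec \<sigma> V n) (codriven_vec \<sigma> V n) = lor V V"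
  by (induction n) (auto simp: lor_refl_refl)

lemma codriven_vec_int: "norm \<sigma> = 1 \<Longrightarrow> int_vec V \<Longrightarrow> int_vec (codriven_vec \<sigma> V n)"
  by (induction n) (auto intro!: int_vec_refl w_int)

text \<open>From the split time on, the transported normals separate the ends of an arc, so only
  finitely many occur; each has two endpoints, hence some pair repeats. Tracing the repetition back
  makes the period start exactly at \<open>h\<close>.\<close>

lemma pair_periodic:
  assumes "irr \<sigma>" "irr \<rho>" "\<sigma> \<noteq> \<rho>" "int_vec V" "lor V V > 0" "lor V (light \<sigma>) = 0" "lor V (light \<rho>) = 0"
    and h: "h = split_time \<sigma> \<rho>"
  obtains p where "p > 0" "(B ^^ (h + p)) \<sigma> = (B ^^ h) \<sigma>" "codriven \<sigma> \<rho> (h + p) = codriven \<sigma> \<rho> h"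
proof -
  have n: "norm \<sigma> = 1" "norm \<rho> = 1" using assms by auto
  define Vn where "Vn = codriven_vec \<sigma> V"
  define pr where "pr k = ((B ^^ (h + k)) \<sigma>, codriven \<sigma> \<rho> (h + k))" for k
  have Vn: "lor (Vn k) (light ((B ^^ k) \<sigma>)) = 0" "lor (Vn k) (light (codriven \<sigma> \<rho> k)) = 0" "lor (Vn k) (Vn k) = lor V V" "int_vec (Vn k)" for k
    using codriven_vec_perp[of \<sigma> \<sigma> V k] codriven_vec_perp[of \<sigma> \<rho> V k] codriven_vec_norm[of \<sigma> V k] codriven_vec_int[of \<sigma> V k]
      n assms by (auto simp: Vn_def codriven_self)
  define F where "F = (\<Union>a<m. {W. int_vec W \<and> lor W W = lor V V \<and> lor W (light (P a)) * lor W (light (Q a)) < 0})"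
  have "finite F" unfolding F_def using finite_separating assms(5) by blast
  have "Vn (h + k) \<in> F" for k
  proof -
    have "lor (Vn (h + k)) (light (P (idx ((B ^^ (h + k)) \<sigma>)))) * lor (Vn (h + k)) (light (Q (idx ((B ^^ (h + k)) \<sigma>)))) < 0"
      using codriven_after_split[OF assms(1-3), of "h + k"] h assms(5)
      by (intro separating[of "(B ^^ (h + k)) \<sigma>" "codriven \<sigma> \<rho> (h + k)"])
         (auto simp: Vn irr_nonvertex_orbit[OF assms(1)] irr_nonvertex codriven_irr assms(1,2))
    then show ?thesis unfolding F_def using Vn n by auto
  qed
  then have fV: "finite (range (\<lambda>k. Vn (h + k)))" using \<open>finite F\<close> by (meson finite_subset image_subsetI)
  define Z where "Z W = {z. norm z = 1 \<and> lor W (light z) = 0}" for W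
  have Z: "Z (Vn k) = {(B ^^ k) \<sigma>, codriven \<sigma> \<rho> k}" for k
    unfolding Z_def using codriven_neq[OF n assms(3)] codriven_norm[OF n] n Vn assms(5)
    by (intro perp_zeros) auto
  have "range pr \<subseteq> (\<Union>W\<in>range (\<lambda>k. Vn (h + k)). Z W \<times> Z W)"
    by (auto simp: pr_def Z)
  moreover have "finite (\<Union>W\<in>range (\<lambda>k. Vn (h + k)). Z W \<times> Z W)"
    using fV by (intro finite_UN_I) (auto simp: Z)
  ultimately have "finite (range pr)" by (rule finite_subset)
  then have "\<not> inj pr" using finite_imageD infinite_UNIV_nat by blast
  then obtain i j where "i \<noteq> j" "pr i = pr j" by (auto simp: inj_def)
  then obtain i p where ip: "p > 0" "pr i = pr (i + p)"
    by (metis less_imp_add_positive linorder_neqE_nat)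
  \<comment> \<open>The arc of the driven point names the reflection applied last, so a pair
    determines its predecessor.\<close>
  have step: "pr k = pr l" if "pr (Suc k) = pr (Suc l)" for k l
  proof -
    have e: "(B ^^ Suc (h + k)) \<sigma> = (B ^^ Suc (h + l)) \<sigma>" "codriven \<sigma> \<rho> (Suc (h + k)) = codriven \<sigma> \<rho> (Suc (h + l))"
      using that by (auto simp: pr_def simp del: funpow.simps codriven.simps)
    have "idx (codriven \<sigma> \<rho> (Suc (h + k))) = idx ((B ^^ (h + k)) \<sigma>)" "idx (codriven \<sigma> \<rho> (Suc (h + l))) = idx ((B ^^ (h + l)) \<sigma>)"
      using codriven_after_split_step(1)[OF assms(1-3)] h by auto
    then have i: "idx ((B ^^ (h + k)) \<sigma>) = idx ((B ^^ (h + l)) \<sigma>)" using e by simp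
    have b: "(B ^^ k) \<sigma> = R (idx ((B ^^ k) \<sigma>)) ((B ^^ Suc k) \<sigma>)" for k
      using codriven_back[OF n(1) n(1), of k] by (simp only: codriven_self)
    have "(B ^^ (h + k)) \<sigma> = (B ^^ (h + l)) \<sigma>"
      using b[of "h + k"] b[of "h + l"] e(1) i by simp
    moreover have "codriven \<sigma> \<rho> (h + k) = codriven \<sigma> \<rho> (h + l)"
      using codriven_back[OF n, of "h + k"] codriven_back[OF n, of "h + l"] e(2) i by simp
    ultimately show ?thesis by (simp add: pr_def)
  qed
  have "pr 0 = pr p" using ip(2)
  proof (induction i)
    case (Suc i)
    then show ?case using step[of i "i + p"] by simp
  qed simp
  then show thesis using that[of p] ip(1) by (simp add: pr_def)
qed

section \<open>Terminating, preperiodic and quadratic points\<close>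

lemma vertex_constant:
  assumes "norm \<sigma> = 1" "\<not> nonvertex ((B ^^ n) \<sigma>)"
  shows "symbolic_seq m t \<sigma> !! (n + k) = idx ((B ^^ n) \<sigma>)"
proof -
  define y where "y = (B ^^ n) \<sigma>"
  have y: "norm y = 1" "y = P (idx y)" using assms by (auto simp: nonvertex_def y_def)
  have "B y = R (idx y) (P (idx y))" using y(2) unfolding B_eq by metis
  also have "\<dots> = y" using R_P[of "idx y"] y by simp
  finally have "(B ^^ k) y = y" by (induction k) auto
  then show ?thesis by (simp add: symbolic_snth B_pow_add y_def)
qed

text \<open>A repeated arc in consecutive steps occurs only at a vertex, which an orbit outside Q(i)
  never meets; points of Q(i) reach a vertex, and \<open>B\<close> fixes it.\<close>

lemma terminating_iff:
  assumes "norm \<sigma> = 1"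
  shows "B_terminating m t \<sigma> \<longleftrightarrow> \<not> irr \<sigma>"
proof
  assume "B_terminating m t \<sigma>"
  then obtain h a where e: "sdrop h (symbolic_seq m t \<sigma>) = sconst a" by (auto simp: B_terminating_def)
  have "symbolic_seq m t \<sigma> !! (h + k) = a" for k
    using arg_cong[OF e, of "\<lambda>s. s !! k"] by (simp add: sdrop_snth)
  from this[of 0] this[of 1] have "idx ((B ^^ h) \<sigma>) = idx (B ((B ^^ h) \<sigma>))" unfolding symbolic_snth by simp
  then show "\<not> irr \<sigma>" using idx_B_neq irr_nonvertex_orbit by metis
next
  assume "\<not> irr \<sigma>"
  then obtain n where n: "\<not> nonvertex ((B ^^ n) \<sigma>)"
    using rational_reaches_vertex assms by (auto simp: irr_def)
  have "sdrop n (symbolic_seq m t \<sigma>) = sconst (idx ((B ^^ n) \<sigma>))"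
    by (rule stream_ext) (use vertex_constant[OF assms n] in \<open>simp add: sdrop_snth\<close>)
  then show "B_terminating m t \<sigma>" unfolding B_terminating_def by blast
qed

lemma ex_interior_point:
  assumes "b < m"
  obtains z where "nonvertex z" "idx z = b"
proof -
  define s where "s = (vangle b + vangle (Suc b)) / 2"
  have lt: "vangle b < vangle (Suc b)" "vangle (Suc b) \<le> vangle m" using assms by (auto intro: vangle_less vangle_le)
  then have s: "vangle b < s" "s < vangle (Suc b)" "0 \<le> s" "s < 2 * pi"
    using vangle_range(1)[of b] assms by (auto simp: s_def vangle_def[of m])
  define z where "z = P 0 * cis s"
  have z: "norm z = 1" by (simp add: z_def norm_mult)
  have "angle_of z = s" unfolding angle_of_def z_def using ccw_angle_cis[of "P 0" 0 s] s by simp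
  then have "idx z = b" "z \<noteq> P b" using idx_iff[OF z assms] angle_of_eq_iff[OF z assms] s by auto
  then show thesis using that[of z] z by (simp add: nonvertex_def)
qed

text \<open>Injectivity of itineraries turns symbolic periodicity into a coincidence of two driven
  maps at \<sigma>. To yield an equation for \<sigma>, the coincidence must fail at some other
  point.\<close>

lemma preperiodic_imp_quadratic:
  assumes "norm \<sigma> = 1" "B_preperiodic m t \<sigma>"
  shows "irr \<sigma>" "quadratic_over_Qi \<sigma>"
proof -
  obtain u v where mf: "minimal_periodic_form (symbolic_seq m t \<sigma>) u v" and v2: "length v \<ge> 2"
    using assms(2) by (auto simp: B_preperiodic_def)
  then have v: "v \<noteq> []" "symbolic_seq m t \<sigma> = u @- cycle v" by (auto simp: minimal_periodic_form_def)
  show irr: "irr \<sigma>"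
  proof (rule ccontr)
    assume "\<not> irr \<sigma>"
    then obtain n a where "sdrop n (symbolic_seq m t \<sigma>) = sconst a" using terminating_iff[OF assms(1)] unfolding B_terminating_def by blast
    then have "symbolic_seq m t \<sigma> = stake n (symbolic_seq m t \<sigma>) @- cycle [a]"
      by (metis sconst_cycle stake_sdrop)
    then have "length v \<le> length [a]" using mf unfolding minimal_periodic_form_def by blast
    then show False using v2 by simp
  qed
  define h p where "h = length u" and "p = length v"
  have p: "p \<ge> 2" using v2 by (simp add: p_def)
  have per: "idx ((B ^^ (n + p)) \<sigma>) = idx ((B ^^ n) \<sigma>)" if "n \<ge> h" for n
    using shift_cycle_periodic[OF v(1), of u n] that unfolding v(2)[symmetric] symbolic_snth h_def p_def by simp
  have same: "(B ^^ (h + p)) \<sigma> = (B ^^ h) \<sigma>"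
  proof (rule itinerary_inj)
    fix n
    show "nonvertex ((B ^^ n) ((B ^^ (h + p)) \<sigma>))" "nonvertex ((B ^^ n) ((B ^^ h) \<sigma>))"
      unfolding B_pow_add[symmetric] by (rule irr_nonvertex_orbit[OF irr])+
    show "idx ((B ^^ n) ((B ^^ (h + p)) \<sigma>)) = idx ((B ^^ n) ((B ^^ h) \<sigma>))"
      unfolding B_pow_add[symmetric] using per[of "h + n"] by (simp add: ac_simps)
  qed
  define a where "a = idx ((B ^^ h) \<sigma>)"
  define a' where "a' = idx ((B ^^ (h + p - 1)) \<sigma>)"
  \<comment> \<open>Three arcs leave one, \<open>b\<close>, besides the arcs of \<sigma> at times
    \<open>h\<close> and \<open>h + p - 1\<close>. A point driven into \<open>b\<close> at time
    \<open>h\<close> stays apart from \<sigma>, so at time \<open>h + p\<close> it lies in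
    \<open>a'\<close>, and the two maps differ.\<close>
  have "\<not> {..<m} \<subseteq> {a, a'}"
  proof
    assume "{..<m} \<subseteq> {a, a'}"
    then have "m \<le> card {a, a'}" using card_mono[of "{a, a'}" "{..<m}"] by simp
    also have "\<dots> \<le> 2" by (simp add: card_insert_if)
    finally show False using m3 by simp
  qed
  then obtain b where b: "b < m" "b \<noteq> a" "b \<noteq> a'" by auto
  obtain z where z: "nonvertex z" "idx z = b" using ex_interior_point[OF b(1)] .
  obtain y where y: "norm y = 1" "codriven \<sigma> y h = z"
    using codriven_surj[OF assms(1), of z h] z by (auto simp: nonvertex_def)
  have "idx (codriven \<sigma> y (Suc (h + p - 1))) = idx ((B ^^ (h + p - 1)) \<sigma>)"
  proof -
    have "nonvertex (codriven \<sigma> y (h + p - 1)) \<and> idx (codriven \<sigma> y (h + p - 1)) \<noteq> idx ((B ^^ (h + p - 1)) \<sigma>)"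
      using y z b p by (intro codriven_apart[of \<sigma> y h] irr_nonvertex_orbit irr) (auto simp: a_def)
    then show ?thesis using codriven_apart_step(2)[OF irr_nonvertex_orbit[OF irr]] by blast
  qed
  then have "idx (codriven \<sigma> y (h + p)) = a'" using p by (simp add: a'_def del: codriven.simps)
  then have ne: "codriven \<sigma> y (h + p) \<noteq> codriven \<sigma> y h" using y z b by auto
  show "quadratic_over_Qi \<sigma>"
    by (rule coincidence_quadratic[OF codriven_moebius[OF assms(1), of "h + p"] codriven_moebius[OF assms(1), of h] assms(1) _ _ y(1) ne])
       (use irr same in \<open>auto simp: irr_def codriven_self\<close>)
qed

text \<open>A representation whose preperiod cannot be shortened decides periodicity, even when
  \<open>v0\<close> repeats the minimal period; irrationality excludes period one.\<close>

lemma periodic_form_facts: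
  assumes "irr \<sigma>" "symbolic_seq m t \<sigma> = u0 @- cycle v0" "v0 \<noteq> []" "u0 \<noteq> [] \<Longrightarrow> last u0 \<noteq> last v0"
  shows "B_preperiodic m t \<sigma>" "B_periodic m t \<sigma> \<longleftrightarrow> u0 = []"
proof -
  have two: "length v \<ge> 2" if "minimal_periodic_form (symbolic_seq m t \<sigma>) u v" for u v
  proof (rule ccontr)
    assume "\<not> length v \<ge> 2"
    moreover have v: "v \<noteq> []" "symbolic_seq m t \<sigma> = u @- cycle v" using that by (auto simp: minimal_periodic_form_def)
    ultimately obtain a where "v = [a]" by (cases v rule: list.exhaust; cases "tl v") auto
    then have "sdrop (length u) (symbolic_seq m t \<sigma>) = sconst a" using v(2) by (simp add: sdrop_shift sconst_cycle)
    then show False using terminating_iff[of \<sigma>] assms(1) unfolding B_terminating_def by auto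
  qed
  obtain u v where mf: "minimal_periodic_form (symbolic_seq m t \<sigma>) u v"
    using ex_minimal_periodic_form[OF assms(3,2)] .
  then show "B_preperiodic m t \<sigma>" using two unfolding B_preperiodic_def by blast
  have u: "u = u0" by (rule minimal_periodic_form_unique_preperiod[OF mf assms(2-4)])
  show "B_periodic m t \<sigma> \<longleftrightarrow> u0 = []"
  proof
    assume "u0 = []"
    then show "B_periodic m t \<sigma>" using mf two u unfolding B_periodic_def by blast
  next
    assume "B_periodic m t \<sigma>"
    then obtain v' where "minimal_periodic_form (symbolic_seq m t \<sigma>) [] v'" by (auto simp: B_periodic_def)
    from minimal_periodic_form_unique_preperiod(1)[OF this assms(2-4)] show "u0 = []" by simp
  qed
qed

lemma quadratic_imp_preperiodic:
  assumes "norm \<sigma> = 1" "quadratic_over_Qi \<sigma>"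
  defines "\<rho> \<equiv> galois_conjugate \<sigma>"
  shows "B_preperiodic m t \<sigma>" "norm \<rho> = 1"
    "minimal_periodic_form (symbolic_seq m t \<sigma>) u v \<Longrightarrow>
       (u \<noteq> [] \<longrightarrow> last u \<noteq> last v) \<and> symbolic_seq m t \<rho> = u @- cycle (rev v)"
    "B_periodic m t \<sigma> \<longleftrightarrow> B_periodic m t \<rho>"
    "B_periodic m t \<sigma> \<longleftrightarrow> (\<sigma>, \<rho>) \<in> S_B m t"
proof -
  obtain b c where bc: "\<sigma> \<notin> gaussian_rats" "b \<in> gaussian_rats" "c \<in> gaussian_rats" "\<sigma>\<^sup>2 + b * \<sigma> + c = 0"
    using assms(2) unfolding quadratic_over_Qi_iff by blast
  have r: "\<rho> = - b - \<sigma>" "\<rho> \<noteq> \<sigma>" "\<rho> \<notin> gaussian_rats"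
    using galois_conjugate_eq[OF bc] by (auto simp: \<rho>_def)
  show rn: "norm \<rho> = 1" using galois_conjugate_on_circle[OF assms(1) bc] by (simp add: r)
  have irr: "irr \<sigma>" "irr \<rho>" using assms(1) bc(1) rn r by (auto simp: irr_def)
  obtain V where V: "int_vec V" "lor V V > 0" "lor V (light \<sigma>) = 0" "lor V (light \<rho>) = 0"
    using ex_int_normal[OF assms(1) bc] r(1) by auto
  define h where "h = split_time \<sigma> \<rho>"
  obtain p where p: "p > 0" "(B ^^ (h + p)) \<sigma> = (B ^^ h) \<sigma>" "codriven \<sigma> \<rho> (h + p) = codriven \<sigma> \<rho> h"
    using pair_periodic[OF irr r(2)[symmetric] V h_def] by blast
  define u0 where "u0 = stake h (symbolic_seq m t \<sigma>)"
  define v0 where "v0 = stake p (sdrop h (symbolic_seq m t \<sigma>))"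
  have v0: "v0 \<noteq> []" using p(1) by (metis v0_def length_stake list.size(3) less_irrefl)
  note rv = reversal[OF irr r(2)[symmetric] h_def p, folded u0_def v0_def]
  note f1 = periodic_form_facts[OF irr(1) rv(1) v0]
  note f2 = periodic_form_facts[OF irr(2) rv(2)]
  show "B_preperiodic m t \<sigma>" using f1 rv(3) by blast
  show per: "B_periodic m t \<sigma> \<longleftrightarrow> B_periodic m t \<rho>" using f1(2) f2(2) v0 rv(3) by simp
  {
    assume mf: "minimal_periodic_form (symbolic_seq m t \<sigma>) u v"
    have e: "u = u0" "cycle v = cycle v0" "last v = last v0"
      using minimal_periodic_form_unique_preperiod[OF mf rv(1) v0] rv(3) by blast+
    have "v \<noteq> []" using mf by (simp add: minimal_periodic_form_def)
    then have "cycle (rev v) = cycle (rev v0)" using cycle_rev_eq[OF e(2) _ v0] by simp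
    then show "(u \<noteq> [] \<longrightarrow> last u \<noteq> last v) \<and> symbolic_seq m t \<rho> = u @- cycle (rev v)"
      using rv(2,3) e by simp
  }
  \<comment> \<open>The minimal preperiod is the split time, which vanishes exactly when the two
    points start in different arcs.\<close>
  have "B_periodic m t \<sigma> \<longleftrightarrow> u0 = []" using f1(2) rv(3) by blast
  also have "\<dots> \<longleftrightarrow> h = 0" unfolding u0_def by (metis length_0_conv length_stake)
  also have "\<dots> \<longleftrightarrow> idx \<sigma> \<noteq> idx \<rho>" unfolding h_def by (rule split_time_0_iff[OF irr r(2)[symmetric]])
  also have "\<dots> \<longleftrightarrow> (\<sigma>, \<rho>) \<in> S_B m t"
  proof -
    have "(\<exists>a<m. \<exists>b<m. a \<noteq> b \<and> \<sigma> \<in> partition_arc m t a \<and> \<rho> \<in> partition_arc m t b) \<longleftrightarrow> idx \<sigma> \<noteq> idx \<rho>"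
      using arc_iff[OF assms(1)] arc_iff[OF rn] idx_less[OF assms(1)] idx_less[OF rn] by metis
    then show ?thesis using assms(1) rn irr terminating_iff by (auto simp: S_B_def)
  qed
  finally show "B_periodic m t \<sigma> \<longleftrightarrow> (\<sigma>, \<rho>) \<in> S_B m t" .
qed

end

theorem theorem8p3:
  fixes m :: nat and t :: "nat \<Rightarrow> int ^ 3" and \<sigma> :: complex
  assumes "unimodular_partition m t" and "\<sigma> \<in> sphere 0 1"
  shows "(B_preperiodic m t \<sigma> \<longleftrightarrow> quadratic_over_Qi \<sigma>) \<and>
    (B_preperiodic m t \<sigma> \<longrightarrow>
       galois_conjugate \<sigma> \<in> sphere 0 1 \<and>
       (\<forall>u v. minimal_periodic_form (symbolic_seq m t \<sigma>) u v \<longrightarrow>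
          (u \<noteq> [] \<longrightarrow> last u \<noteq> last v) \<and>
          symbolic_seq m t (galois_conjugate \<sigma>) = u @- cycle (rev v)) \<and>
       (B_periodic m t \<sigma> \<longleftrightarrow> B_periodic m t (galois_conjugate \<sigma>)) \<and>
       (B_periodic m t \<sigma> \<longleftrightarrow> (\<sigma>, galois_conjugate \<sigma>) \<in> S_B m t))"
proof -
  interpret partition m t by standard (rule assms(1))
  have n: "norm \<sigma> = 1" using assms(2) by simp
  have iff: "B_preperiodic m t \<sigma> \<longleftrightarrow> quadratic_over_Qi \<sigma>"
    using preperiodic_imp_quadratic(2)[OF n] quadratic_imp_preperiodic(1)[OF n] by blast
  show ?thesis
  proof (intro conjI impI iff allI)
    assume "B_preperiodic m t \<sigma>"
    then have q: "quadratic_over_Qi \<sigma>" using iff by simp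
    show "galois_conjugate \<sigma> \<in> sphere 0 1" using quadratic_imp_preperiodic(2)[OF n q] by simp
    show "B_periodic m t \<sigma> \<longleftrightarrow> B_periodic m t (galois_conjugate \<sigma>)" by (rule quadratic_imp_preperiodic(4)[OF n q])
    show "B_periodic m t \<sigma> \<longleftrightarrow> (\<sigma>, galois_conjugate \<sigma>) \<in> S_B m t" by (rule quadratic_imp_preperiodic(5)[OF n q])
    fix u v
    assume mf: "minimal_periodic_form (symbolic_seq m t \<sigma>) u v"
    show "symbolic_seq m t (galois_conjugate \<sigma>) = u @- cycle (rev v)" using quadratic_imp_preperiodic(3)[OF n q mf] by simp
    show "last u \<noteq> last v" if "u \<noteq> []" using quadratic_imp_preperiodic(3)[OF n q mf] that by simp
  qed
qed

end
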